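(* Let $D=(0,1)$, $\alpha\in(1,2)$, $f\in W^{1,\infty}(D)$, and let $u(x)=-({}_0I_x^\alpha f)(x)+({}_0I_x^\alpha f)(1)x^{\alpha-1}$ be the solution of $-{}_0^RD_x^\alpha u=f$ in $D$, $u(0)=u(1)=0$. For $k\in\{0,1\}$ let $V_h$ be the finite element space defined below, let $w_h\in V_h$ satisfy $(w_h',v_h')=(f,v_h)$ for all $v_h\in V_h$ (the Galerkin approximation of $-w''=f$, $w(0)=w(1)=0$), and set $u_h={}_0^RD_x^{2-\alpha}w_h-({}_0^RD_x^{2-\alpha}w_h)(1)x^{\alpha-1}$. Then $$\|u-u_h\|_{L^2(D)}\le ch^{\alpha+k}\|f\|_{W^{1,\infty}(D)},$$ with $c$ independent of $h$ and $f$.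
   Context: $(\cdot,\cdot)$ is the $L^2(D)$ inner product. $({}_0I_x^\gamma g)(x)=\frac{1}{\Gamma(\gamma)}\int_0^x(x-t)^{\gamma-1}g(t)dt$; ${}_0^RD_x^\alpha u=\frac{d^2}{dx^2}({}_0I_x^{2-\alpha}u)$. For $w\in H^1_0(D)$ (sufficiently regular near $x=1$ for the endpoint value), ${}_0^RD_x^{2-\alpha}w(x)=\frac{1}{\Gamma(\alpha-1)}\int_0^x(x-t)^{\alpha-2}w'(t)dt$ and $({}_0^RD_x^{2-\alpha}w)(1)=\frac{1}{\Gamma(\alpha-1)}\int_0^1(1-t)^{\alpha-2}w'(t)dt$. $V_h$: for a quasi-uniform partition of $D$ with maximal subinterval length $h$, the space of continuous piecewise polynomials of degree at most $k+1$ vanishing at $0$ and $1$. *)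

theory Defs
  imports "HOL-Analysis.Analysis" "HOL-Computational_Algebra.Polynomial"
begin

definition frac_int :: "real \<Rightarrow> (real \<Rightarrow> real) \<Rightarrow> real \<Rightarrow> real" where
  "frac_int \<gamma> g x = integral {0..x} (\<lambda>t. (x - t) powr (\<gamma> - 1) * g t) / Gamma \<gamma>"

(* Riemann--Liouville derivative of order beta in (0,1) of w in H^1_0(D),
   given (as in the paper) by  1/Gamma(1-beta) int_0^x (x-t)^(-beta) w'(t) dt;
   with beta = 2 - alpha this is the paper's formula for _0^R D_x^{2-alpha} w *)
definition RL_deriv :: "real \<Rightarrow> (real \<Rightarrow> real) \<Rightarrow> real \<Rightarrow> real" where
  "RL_deriv \<beta> w x = integral {0..x} (\<lambda>t. (x - t) powr (- \<beta>) * deriv w t) / Gamma (1 - \<beta>)"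

definition exact_sol :: "real \<Rightarrow> (real \<Rightarrow> real) \<Rightarrow> real \<Rightarrow> real" where
  "exact_sol \<alpha> f x = - frac_int \<alpha> f x + frac_int \<alpha> f 1 * x powr (\<alpha> - 1)"

definition post_sol :: "real \<Rightarrow> (real \<Rightarrow> real) \<Rightarrow> real \<Rightarrow> real" where
  "post_sol \<alpha> wh x = RL_deriv (2 - \<alpha>) wh x - RL_deriv (2 - \<alpha>) wh 1 * x powr (\<alpha> - 1)"

definition is_partition :: "nat \<Rightarrow> (nat \<Rightarrow> real) \<Rightarrow> bool" where
  "is_partition N p \<longleftrightarrow> N \<ge> 1 \<and> p 0 = 0 \<and> p N = 1 \<and> (\<forall>i<N. p i < p (Suc i))"

definition mesh :: "nat \<Rightarrow> (nat \<Rightarrow> real) \<Rightarrow> real" where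
  "mesh N p = Max ((\<lambda>i. p (Suc i) - p i) ` {..<N})"

definition quasi_uniform :: "real \<Rightarrow> nat \<Rightarrow> (nat \<Rightarrow> real) \<Rightarrow> bool" where
  "quasi_uniform \<sigma> N p \<longleftrightarrow> (\<forall>i<N. mesh N p \<le> \<sigma> * (p (Suc i) - p i))"

definition Vh :: "nat \<Rightarrow> nat \<Rightarrow> (nat \<Rightarrow> real) \<Rightarrow> (real \<Rightarrow> real) set" where
  "Vh k N p = {v. continuous_on {0..1} v \<and> v 0 = 0 \<and> v 1 = 0 \<and>
     (\<forall>i<N. \<exists>q :: real poly. degree q \<le> k + 1 \<and> (\<forall>x\<in>{p i..p (Suc i)}. v x = poly q x))}"

definition test_fun :: "(real \<Rightarrow> real) \<Rightarrow> bool" where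
  "test_fun \<phi> \<longleftrightarrow> (\<forall>n x. ((deriv ^^ n) \<phi>) differentiable (at x)) \<and>
     (\<exists>a b. 0 < a \<and> b < 1 \<and> (\<forall>x. x \<notin> {a..b} \<longrightarrow> \<phi> x = 0))"

definition weak_deriv :: "(real \<Rightarrow> real) \<Rightarrow> (real \<Rightarrow> real) \<Rightarrow> bool" where
  "weak_deriv f g \<longleftrightarrow> (\<forall>\<phi>. test_fun \<phi> \<longrightarrow>
     integral {0..1} (\<lambda>x. f x * deriv \<phi> x) = - integral {0..1} (\<lambda>x. g x * \<phi> x))"

definition Linf :: "(real \<Rightarrow> real) \<Rightarrow> bool" where
  "Linf g \<longleftrightarrow> g \<in> borel_measurable (lebesgue_on {0<..<1}) \<and>
     (\<exists>M. AE x in lebesgue. x \<in> {0<..<1} \<longrightarrow> \<bar>g x\<bar> \<le> M)"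

definition Linf_norm :: "(real \<Rightarrow> real) \<Rightarrow> real" where
  "Linf_norm g = Inf {M. AE x in lebesgue. x \<in> {0<..<1} \<longrightarrow> \<bar>g x\<bar> \<le> M}"

definition W1inf :: "(real \<Rightarrow> real) \<Rightarrow> (real \<Rightarrow> real) \<Rightarrow> bool" where
  "W1inf f g \<longleftrightarrow> Linf f \<and> Linf g \<and> weak_deriv f g"

definition W1inf_norm :: "(real \<Rightarrow> real) \<Rightarrow> (real \<Rightarrow> real) \<Rightarrow> real" where
  "W1inf_norm f g = Linf_norm f + Linf_norm g"

definition L2_norm :: "(real \<Rightarrow> real) \<Rightarrow> real" where
  "L2_norm g = sqrt (integral {0..1} (\<lambda>x. (g x)\<^sup>2))"

end

theory Submission
  imports Defs
begin

text \<open>Let \<open>F\<close> be the primitive of \<open>f\<close> and \<open>\<epsilon> = w' - w\<^sub>h'\<close>. Then \<open>u - u\<^sub>h\<close> is a combination of values of the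
  fractional integral of order \<open>\<alpha> - 1\<close> of \<open>\<epsilon>\<close>. In one dimension Galerkin orthogonality is local: on each
  element \<open>\<epsilon>\<close> is orthogonal to the polynomials of degree at most \<open>k\<close>, so \<open>\<epsilon>\<close> is of size \<open>h ^ (k + 1)\<close> and
  its primitive, which vanishes at the nodes, is of size \<open>h ^ (k + 2)\<close>. Splitting the singular kernel at
  distance \<open>h\<close> from its singularity and integrating by parts in the far part gives the pointwise rate
  \<open>h powr (\<alpha> + k)\<close>.\<close>

section \<open>Integration by parts with a merely bounded factor\<close>

text \<open>The boundary conditions force \<open>w' = c - F\<close> with \<open>c\<close> the mean
  of \<open>F\<close>. Fractional integration of order \<alpha> - 1 turns \<open>c\<close> into a
  multiple of \<open>x powr (\<alpha> - 1)\<close>, which is what the correction by the value at 1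
  removes; so \<open>u\<close> arises from \<open>w'\<close> exactly as \<open>u_h\<close> arises
  from \<open>w_h'\<close>.

  Locality comes from the derivatives of \<open>Vh\<close> being all piecewise polynomials of degree
  at most \<open>k\<close> with mean zero, while \<epsilon> has mean zero itself.

  The obstacle is the low regularity of the data: \<open>f\<close> matters only up to null sets, and
  its derivative is known only through integrals against test functions. No Lipschitz representative
  is built. The size of \<epsilon> on an element depends only on how well a polynomial of degree at
  most \<open>k\<close> approximates \<open>F\<close> there. For \<open>k = 0\<close> boundedness of
  \<open>f\<close> suffices. For \<open>k = 1\<close> second differences of \<open>F\<close> must be
  small, and such a difference is, up to scaling, the integral of \<open>f\<close> against the
  derivative of a hat function. Hats are not smooth, hence the explicit smooth approximations built
  from \<open>exp (- inverse x)\<close>.\<close>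

lemma constant_if_quadratic_increments:
  fixes \<Phi> :: "real \<Rightarrow> real"
  assumes "a \<le> b" and bound: "\<And>s s'. a \<le> s \<Longrightarrow> s \<le> s' \<Longrightarrow> s' \<le> b \<Longrightarrow> \<bar>\<Phi> s' - \<Phi> s\<bar> \<le> C * (s' - s)\<^sup>2"
  shows "\<Phi> b = \<Phi> a"
proof -
  have sym: "\<bar>\<Phi> y - \<Phi> x\<bar> \<le> C * \<bar>y - x\<bar>\<^sup>2" if "x \<in> {a..b}" "y \<in> {a..b}" for x y
    using bound[of x y] bound[of y x] that
    by (cases "x \<le> y") (auto simp: abs_minus_commute power2_commute)
  have "(\<Phi> has_real_derivative 0) (at x within {a..b})" if x: "x \<in> {a..b}" for x
  proof -
    have "((\<lambda>y. (\<Phi> y - \<Phi> x) / (y - x)) \<longlongrightarrow> 0) (at x within {a..b})"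
    proof (rule Lim_null_comparison)
      show "\<forall>\<^sub>F y in at x within {a..b}. norm ((\<Phi> y - \<Phi> x) / (y - x)) \<le> C * \<bar>y - x\<bar>"
        unfolding eventually_at_filter
      proof (intro always_eventually allI impI)
        fix y assume "y \<noteq> x" "y \<in> {a..b}"
        then show "norm ((\<Phi> y - \<Phi> x) / (y - x)) \<le> C * \<bar>y - x\<bar>"
          using sym[OF x, of y] by (simp add: field_simps power2_eq_square)
      qed
      have "((\<lambda>y. C * \<bar>y - x\<bar>) \<longlongrightarrow> C * \<bar>x - x\<bar>) (at x within {a..b})"
        by (intro tendsto_intros)
      then show "((\<lambda>y. C * \<bar>y - x\<bar>) \<longlongrightarrow> 0) (at x within {a..b})" by simp
    qed
    then show ?thesis by (simp add: has_field_derivative_iff)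
  qed
  then have "\<exists>c. \<forall>x\<in>{a..b}. \<Phi> x = c"
    by (intro has_field_derivative_zero_constant) auto
  then show ?thesis using assms(1) by auto
qed

lemma absolutely_integrable_mult_bounded:
  fixes f k :: "real \<Rightarrow> real"
  assumes f: "f integrable_on {a..b}" and bd: "\<And>t. t \<in> {a..b} \<Longrightarrow> \<bar>f t\<bar> \<le> M"
    and k: "k absolutely_integrable_on {a..b}"
  shows "(\<lambda>t. k t * f t) absolutely_integrable_on {a..b}"
proof -
  have "f \<in> borel_measurable (lebesgue_on {a..b})"
    using f integrable_imp_measurable by blast
  moreover have "bounded (f ` {a..b})"
    unfolding bounded_iff using bd by (intro exI[of _ M]) auto
  ultimately have "(\<lambda>t. f t * k t) absolutely_integrable_on {a..b}"
    using k by (intro absolutely_integrable_bounded_measurable_product_real) auto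
  then show ?thesis by (simp add: mult.commute)
qed

lemma continuous_on_Icc_abs_bounded:
  fixes f :: "real \<Rightarrow> real"
  assumes "continuous_on {a..b} f"
  obtains K where "\<forall>t\<in>{a..b}. \<bar>f t\<bar> \<le> K"
proof -
  have "bounded (f ` {a..b})"
    by (intro compact_imp_bounded compact_continuous_image assms compact_Icc)
  then show ?thesis using that by (force simp: bounded_iff)
qed

text \<open>A non-integrable \<open>f\<close> has integral 0 by convention, and \<open>M\<close> is
  nonnegative because \<open>{a..b}\<close> is nonempty, so the bound survives in that case. It can
  therefore be applied to products with a weak derivative and to squared errors without an
  integrability argument.\<close>

lemma abs_integral_le_bound:
  fixes f :: "real \<Rightarrow> real"
  assumes "a \<le> b" and "\<And>t. t \<in> {a..b} \<Longrightarrow> \<bar>f t\<bar> \<le> M"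
  shows "\<bar>integral {a..b} f\<bar> \<le> M * (b - a)"
proof (cases "f integrable_on {a..b}")
  case True
  then have "norm (integral {a..b} f) \<le> integral {a..b} (\<lambda>_. M)"
    using assms by (intro integral_norm_bound_integral) auto
  then show ?thesis using assms by (simp add: mult.commute)
next
  case False
  have "M \<ge> 0" using assms(2)[of a] assms(1) by (smt (verit) atLeastAtMost_iff)
  then show ?thesis using assms False by (simp add: not_integrable_integral)
qed

text \<open>Here \<open>f\<close> is merely bounded and integrable, so \<open>F\<close> need not be differentiable; instead the defect
  of the identity is shown to have quadratically small increments.\<close>

lemma integral_by_parts_bounded:
  fixes f k k' :: "real \<Rightarrow> real" and a b M :: real
  defines "F \<equiv> \<lambda>t. integral {a..t} f"
  assumes "a \<le> b" and f: "f integrable_on {a..b}" and bd: "\<And>t. t \<in> {a..b} \<Longrightarrow> \<bar>f t\<bar> \<le> M"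
    and contk: "continuous_on {a..b} k" and "finite S"
    and k: "\<And>t. t \<in> {a<..<b} - S \<Longrightarrow> (k has_real_derivative k' t) (at t)"
    and ik': "k' integrable_on {a..b}" and K: "\<And>t. t \<in> {a..b} \<Longrightarrow> \<bar>k' t\<bar> \<le> K"
  shows "integral {a..b} (\<lambda>t. k t * f t) = k b * F b - integral {a..b} (\<lambda>t. k' t * F t)"
proof -
  have contF: "continuous_on {a..b} F"
    unfolding F_def by (rule indefinite_integral_continuous_1[OF f])
  have ikf: "(\<lambda>t. k t * f t) integrable_on {a..b}"
    by (intro set_lebesgue_integral_eq_integral(1)
        absolutely_integrable_mult_bounded[OF f bd] absolutely_integrable_continuous_real contk)
  have "(\<lambda>t. F t * k' t) integrable_on {a..b}"
    by (intro set_lebesgue_integral_eq_integral(1)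
        absolutely_integrable_mult_bounded[OF ik' K] absolutely_integrable_continuous_real contF)
  then have ikF: "(\<lambda>t. k' t * F t) integrable_on {a..b}" by (simp add: mult.commute)
  have K0: "K \<ge> 0" and M0: "M \<ge> 0" using K[of a] bd[of a] \<open>a \<le> b\<close> by force+
  have kder: "(k' has_integral (k s' - k s)) {s..s'}" if "a \<le> s" "s \<le> s'" "s' \<le> b" for s s'
    using that k contk
    by (intro fundamental_theorem_of_calculus_interior_strong[OF \<open>finite S\<close>])
       (auto simp: has_real_derivative_iff_has_vector_derivative intro: continuous_on_subset)
  let ?\<Phi> = "\<lambda>s. integral {a..s} (\<lambda>t. k t * f t) - k s * F s + integral {a..s} (\<lambda>t. k' t * F t)"
  have "?\<Phi> b = ?\<Phi> a"
  proof (rule constant_if_quadratic_increments[where C = "2 * K * M" and \<Phi> = ?\<Phi> and a = a and b = b])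
    fix s s' assume s: "a \<le> s" "s \<le> s'" "s' \<le> b"
    have split: "integral {a..s'} g = integral {a..s} g + integral {s..s'} g"
      if "g integrable_on {a..b}" for g :: "real \<Rightarrow> real"
      using s integrable_subinterval_real[OF that, of a s']
      by (subst Henstock_Kurzweil_Integration.integral_combine[symmetric]) auto
    have sub: "g integrable_on {s..s'}" if "g integrable_on {a..b}" for g :: "real \<Rightarrow> real"
      using s integrable_subinterval_real[OF that] by auto
    have i1: "f integrable_on {s..s'}" "(\<lambda>t. k t * f t) integrable_on {s..s'}"
      "(\<lambda>t. k' t * F t) integrable_on {s..s'}" "k' integrable_on {s..s'}"
      using sub f ikf ikF ik' by blast+
    have e1: "integral {s..s'} (\<lambda>t. (k t - k s') * f t) =
        integral {s..s'} (\<lambda>t. k t * f t) - k s' * integral {s..s'} f"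
      using i1 by (simp add: left_diff_distrib integral_diff integrable_on_mult_right)
    have e2: "integral {s..s'} (\<lambda>t. k' t * (F t - F s)) =
        integral {s..s'} (\<lambda>t. k' t * F t) - (k s' - k s) * F s"
      using i1 integral_unique[OF kder[OF s]]
      by (simp add: right_diff_distrib integral_diff integrable_on_mult_left)
    have "?\<Phi> s' - ?\<Phi> s = integral {s..s'} (\<lambda>t. (k t - k s') * f t) +
        integral {s..s'} (\<lambda>t. k' t * (F t - F s))"
      unfolding e1 e2 split[OF ikf] split[OF ikF]
      using split[OF f] by (simp add: F_def algebra_simps)
    moreover have "\<bar>integral {s..s'} (\<lambda>t. (k t - k s') * f t)\<bar> \<le> (K * (s' - s) * M) * (s' - s)"
    proof (rule abs_integral_le_bound[OF s(2)])
      fix t assume t: "t \<in> {s..s'}"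
      have "\<bar>integral {t..s'} k'\<bar> \<le> K * (s' - t)"
        by (rule abs_integral_le_bound) (use s t K in auto)
      then have "\<bar>k t - k s'\<bar> \<le> K * (s' - t)"
        using integral_unique[OF kder[of t s']] s t by (simp add: abs_minus_commute)
      also have "\<dots> \<le> K * (s' - s)" using t K0 by (intro mult_left_mono) auto
      finally show "\<bar>(k t - k s') * f t\<bar> \<le> K * (s' - s) * M"
        using bd[of t] s t K0 by (auto simp: abs_mult intro!: mult_mono)
    qed
    moreover have "\<bar>integral {s..s'} (\<lambda>t. k' t * (F t - F s))\<bar> \<le> (K * (M * (s' - s))) * (s' - s)"
    proof (rule abs_integral_le_bound[OF s(2)])
      fix t assume t: "t \<in> {s..s'}"
      have "F t - F s = integral {s..t} f"
        using Henstock_Kurzweil_Integration.integral_combine[of a s t f]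
          integrable_subinterval_real[OF f, of a t] s t by (auto simp: F_def)
      also have "\<bar>\<dots>\<bar> \<le> M * (t - s)"
        by (rule abs_integral_le_bound) (use s t bd in auto)
      also have "\<dots> \<le> M * (s' - s)" using t M0 by (intro mult_left_mono) auto
      finally show "\<bar>k' t * (F t - F s)\<bar> \<le> K * (M * (s' - s))"
        using K[of t] s t K0 by (auto simp: abs_mult intro!: mult_mono)
    qed
    ultimately show "\<bar>?\<Phi> s' - ?\<Phi> s\<bar> \<le> 2 * K * M * (s' - s)\<^sup>2"
      by (simp add: power2_eq_square algebra_simps abs_le_iff)
  qed (use assms in auto)
  then show ?thesis by (simp add: F_def)
qed

section \<open>Fractional integrals of functions with small primitive\<close>

lemma powr_kernel_has_integral:
  fixes x c a :: real
  assumes "c \<le> x" "a > -1"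
  shows "((\<lambda>t. (x - t) powr a) has_integral (x - c) powr (a + 1) / (a + 1)) {c..x}"
proof -
  let ?k = "\<lambda>t. - ((x - t) powr (a + 1) / (a + 1))"
  have "((\<lambda>t. (x - t) powr a) has_integral ?k x - ?k c) {c..x}"
  proof (rule fundamental_theorem_of_calculus_interior[OF assms(1)])
    show "continuous_on {c..x} ?k"
      using assms by (intro continuous_intros continuous_on_powr') auto
    show "(?k has_vector_derivative (x - t) powr a) (at t)" if "t \<in> {c<..<x}" for t
      using that assms unfolding has_real_derivative_iff_has_vector_derivative[symmetric]
      by (auto intro!: derivative_eq_intros simp: powr_diff)
  qed
  then show ?thesis using assms by simp
qed

lemma powr_kernel_absolutely_integrable:
  fixes x c a :: real
  assumes "c \<le> x" "a > -1"
  shows "(\<lambda>t. (x - t) powr a) absolutely_integrable_on {c..x}"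
  by (rule nonnegative_absolutely_integrable_1)
     (use powr_kernel_has_integral[OF assms] in auto)

lemma powr_kernel_mult_integrable:
  fixes f :: "real \<Rightarrow> real"
  assumes "f integrable_on {c..x}" "\<And>t. t \<in> {c..x} \<Longrightarrow> \<bar>f t\<bar> \<le> M" "a > -1"
  shows "(\<lambda>t. (x - t) powr a * f t) integrable_on {c..x}"
proof (cases "c \<le> x")
  case True
  then show ?thesis
    by (intro set_lebesgue_integral_eq_integral(1)
        absolutely_integrable_mult_bounded[OF assms(1,2)] powr_kernel_absolutely_integrable assms)
qed (simp add: integrable_on_empty)

lemma powr_kernel_mult_bound:
  fixes f :: "real \<Rightarrow> real"
  assumes "c \<le> x" "f integrable_on {c..x}" "\<And>t. t \<in> {c..x} \<Longrightarrow> \<bar>f t\<bar> \<le> M" "a > -1"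
  shows "\<bar>integral {c..x} (\<lambda>t. (x - t) powr a * f t)\<bar> \<le> M * ((x - c) powr (a + 1) / (a + 1))"
proof -
  have hi: "((\<lambda>t. M * (x - t) powr a) has_integral M * ((x - c) powr (a + 1) / (a + 1))) {c..x}"
    by (intro has_integral_mult_right powr_kernel_has_integral assms)
  from integral_unique[OF this] have I: "integral {c..x} (\<lambda>t. M * (x - t) powr a) = M * ((x - c) powr (a + 1) / (a + 1))" .
  have "norm (integral {c..x} (\<lambda>t. (x - t) powr a * f t)) \<le>
      integral {c..x} (\<lambda>t. M * (x - t) powr a)"
    using assms hi
    by (intro integral_norm_bound_integral powr_kernel_mult_integrable)
       (auto simp: abs_mult mult.commute intro: mult_right_mono)
  then show ?thesis unfolding I by simp
qed

text \<open>The derivative of the kernel is unbounded at \<open>t = x\<close> when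
  \<open>a < 1\<close>, so the bounded formula is used on \<open>{0..s}\<close> with
  \<open>s < x\<close> only. The defect is continuous in \<open>s\<close> up to \<open>x\<close>,
  where the boundary term vanishes because \<open>a > 0\<close>. With
  \<open>a = \<alpha> - 1\<close> this trades the order \<alpha> integral of \<open>f\<close> for
  the order \<alpha> - 1 integral of its primitive.\<close>

lemma fractional_integral_by_parts:
  fixes f :: "real \<Rightarrow> real"
  defines "F \<equiv> \<lambda>t. integral {0..t} f"
  assumes "0 \<le> x" "a > 0" and f: "f integrable_on {0..x}" and fM: "\<And>t. t \<in> {0..x} \<Longrightarrow> \<bar>f t\<bar> \<le> M"
  shows "integral {0..x} (\<lambda>t. (x - t) powr a * f t) = a * integral {0..x} (\<lambda>t. (x - t) powr (a - 1) * F t)"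
proof (cases "x = 0")
  case False
  then have x: "x > 0" using assms by simp
  have contF: "continuous_on {0..x} F"
    unfolding F_def by (rule indefinite_integral_continuous_1[OF f])
  obtain K where K: "\<forall>t\<in>{0..x}. \<bar>F t\<bar> \<le> K"
    by (rule continuous_on_Icc_abs_bounded[OF contF])
  have i1: "(\<lambda>t. (x - t) powr a * f t) integrable_on {0..x}"
    using powr_kernel_mult_integrable[OF f fM] \<open>a > 0\<close> by simp
  have i2: "(\<lambda>t. (x - t) powr (a - 1) * F t) integrable_on {0..x}"
    using powr_kernel_mult_integrable[OF integrable_continuous_real[OF contF] bspec[OF K]] \<open>a > 0\<close> by simp
  let ?G = "\<lambda>s. integral {0..s} (\<lambda>t. (x - t) powr a * f t) - (x - s) powr a * F s
     - a * integral {0..s} (\<lambda>t. (x - t) powr (a - 1) * F t)"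
  have G0: "?G s = 0" if s: "s \<in> {0..<x}" for s
  proof -
    have cont: "continuous_on {0..s} (\<lambda>t. - (a * (x - t) powr (a - 1)))"
      using s by (intro continuous_intros) auto
    obtain B where B: "\<forall>t\<in>{0..s}. \<bar>- (a * (x - t) powr (a - 1))\<bar> \<le> B"
      by (rule continuous_on_Icc_abs_bounded[OF cont])
    have "integral {0..s} (\<lambda>t. (x - t) powr a * f t) = (x - s) powr a * integral {0..s} f -
        integral {0..s} (\<lambda>t. - (a * (x - t) powr (a - 1)) * integral {0..t} f)"
    proof (rule integral_by_parts_bounded[where S = "{}" and M = M and K = B])
      show "(\<lambda>t. - (a * (x - t) powr (a - 1))) integrable_on {0..s}"
        using cont by (rule integrable_continuous_real)
      show "((\<lambda>t. (x - t) powr a) has_real_derivative - (a * (x - t) powr (a - 1))) (at t)"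
        if "t \<in> {0<..<s} - {}" for t
        using that s by (auto intro!: derivative_eq_intros)
      show "f integrable_on {0..s}" using integrable_subinterval_real[OF f] s by auto
      show "continuous_on {0..s} (\<lambda>t. (x - t) powr a)"
        using s by (intro continuous_intros) auto
      show "\<bar>- (a * (x - t) powr (a - 1))\<bar> \<le> B" if "t \<in> {0..s}" for t
        using that by (rule bspec[OF B])
      show "0 \<le> s" using s by simp
      show "\<bar>f t\<bar> \<le> M" if "t \<in> {0..s}" for t using fM[of t] that s by simp
    qed simp
    then show ?thesis by (simp add: F_def mult.assoc)
  qed
  have Gc: "continuous_on (closure {0..<x}) ?G"
  proof -
    have "continuous_on {0..x} (\<lambda>s. (x - s) powr a)"
      using \<open>a > 0\<close> by (intro continuous_on_powr' continuous_intros) auto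
    then show ?thesis
      unfolding closure_atLeastLessThan[OF x]
      by (intro continuous_on_diff continuous_on_mult continuous_on_const
          indefinite_integral_continuous_1 i1 i2 contF)
  qed
  have "x \<in> closure {0..<x}"
    unfolding closure_atLeastLessThan[OF x] using x by simp
  then have "?G x = 0"
    using continuous_constant_on_closure[of "{0..<x}" ?G 0 x, OF Gc G0] by blast
  then show ?thesis using \<open>a > 0\<close> by simp
qed simp

text \<open>The kernel is cut at distance \<open>h\<close> from its singularity; to the left of the cut, integration by
  parts trades \<open>\<epsilon>\<close> for its primitive, which is smaller by a factor \<open>h\<close>.\<close>

lemma oscillating_kernel_bound:
  fixes \<epsilon> :: "real \<Rightarrow> real"
  assumes x: "0 \<le> x" "x \<le> 1" and h: "h > 0" and a: "0 < a" "a < 1"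
    and int: "\<epsilon> integrable_on {0..1}" and bd: "\<And>t. t \<in> {0..1} \<Longrightarrow> \<bar>\<epsilon> t\<bar> \<le> e"
    and prim: "\<And>t. t \<in> {0..1} \<Longrightarrow> \<bar>integral {0..t} \<epsilon>\<bar> \<le> e * h"
  shows "\<bar>integral {0..x} (\<lambda>t. (x - t) powr (a - 1) * \<epsilon> t)\<bar> \<le> e * h powr a * (1 / a + 2)"
proof -
  have e0: "e \<ge> 0" using bd[of 0] by (smt (verit) atLeastAtMost_iff)
  have near: "\<bar>integral {c..x} (\<lambda>t. (x - t) powr (a - 1) * \<epsilon> t)\<bar> \<le> e * h powr a * (1 / a)"
    if c: "0 \<le> c" "c \<le> x" "x - c \<le> h" for c
  proof -
    have "\<bar>integral {c..x} (\<lambda>t. (x - t) powr (a - 1) * \<epsilon> t)\<bar> \<le> e * ((x - c) powr (a - 1 + 1) / (a - 1 + 1))"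
      using c x a bd integrable_subinterval_real[OF int, of c x] by (intro powr_kernel_mult_bound) auto
    also have "\<dots> \<le> e * (h powr a / a)"
    proof -
      have "(x - c) powr a \<le> h powr a" using c a by (intro powr_mono2) auto
      then show ?thesis using a e0 by (simp add: divide_right_mono mult_left_mono del: times_divide_eq_right)
    qed
    finally show ?thesis by simp
  qed
  show ?thesis
  proof (cases "x \<le> h")
    case True
    then have "\<bar>integral {0..x} (\<lambda>t. (x - t) powr (a - 1) * \<epsilon> t)\<bar> \<le> e * h powr a * (1 / a)"
      using near[of 0] x by simp
    also have "\<dots> \<le> e * h powr a * (1 / a + 2)" using e0 by (intro mult_left_mono) auto
    finally show ?thesis .
  next
    case False
    define c where "c = x - h"
    have c: "0 < c" "c < x" "c \<le> 1" using False h x by (auto simp: c_def)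
    let ?k' = "\<lambda>t. (1 - a) * (x - t) powr (a - 2)"
    have cont: "continuous_on {0..c} ?k'" using c by (intro continuous_intros) auto
    have k: "((\<lambda>t. (x - t) powr (a - 1)) has_real_derivative ?k' t) (at t)" if "t < x" for t
      using that by (auto intro!: derivative_eq_intros simp: algebra_simps)
    have int_c: "\<epsilon> integrable_on {0..c}" using integrable_subinterval_real[OF int] c by auto
    have contk: "continuous_on {0..c} (\<lambda>t. (x - t) powr (a - 1))"
      using c by (intro continuous_intros) auto
    have far: "integral {0..c} (\<lambda>t. (x - t) powr (a - 1) * \<epsilon> t) =
        (x - c) powr (a - 1) * integral {0..c} \<epsilon> - integral {0..c} (\<lambda>t. ?k' t * integral {0..t} \<epsilon>)"
    proof (rule integral_by_parts_bounded[where S = "{}" and M = e and K = "(1 - a) * h powr (a - 2)"])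
      show "\<bar>?k' t\<bar> \<le> (1 - a) * h powr (a - 2)" if "t \<in> {0..c}" for t
        using that a h by (auto simp: abs_mult c_def intro!: mult_left_mono powr_mono2')
    qed (use c bd int_c k contk integrable_continuous_real[OF cont] in auto)
    \<comment> \<open>Since \<open>?k'\<close> is nonnegative, its integral is a difference of
      kernel values and at most \<open>h powr (a - 1)\<close>. Multiplied by the bound
      \<open>e * h\<close> of the primitive this is \<open>e * h powr a\<close>, the same as the
      bound of the boundary term at \<open>c\<close>. These two make up the 2 in the constant; the
      part within distance \<open>h\<close> of \<open>x\<close> gives \<open>1 / a\<close>.\<close>
    have I: "(?k' has_integral (x - c) powr (a - 1) - (x - 0) powr (a - 1)) {0..c}"
      using c k contk
      by (intro fundamental_theorem_of_calculus_interior)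
         (auto simp: has_real_derivative_iff_has_vector_derivative)
    have "norm (integral {0..c} (\<lambda>t. ?k' t * integral {0..t} \<epsilon>)) \<le> integral {0..c} (\<lambda>t. ?k' t * (e * h))"
    proof (rule integral_norm_bound_integral)
      show "(\<lambda>t. ?k' t * integral {0..t} \<epsilon>) integrable_on {0..c}"
        by (intro integrable_continuous_real continuous_intros cont[THEN continuous_on_eq]
            indefinite_integral_continuous_1[OF int_c]) (use c in auto)
      show "norm (?k' t * integral {0..t} \<epsilon>) \<le> ?k' t * (e * h)" if "t \<in> {0..c}" for t
        using that prim[of t] c a by (auto simp: abs_mult intro!: mult_left_mono)
      show "(\<lambda>t. ?k' t * (e * h)) integrable_on {0..c}"
        using I by (intro integrable_on_mult_left) auto
    qed
    also have "\<dots> = ((x - c) powr (a - 1) - (x - 0) powr (a - 1)) * (e * h)"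
      by (rule integral_unique, rule has_integral_mult_left[OF I])
    also have "\<dots> \<le> h powr (a - 1) * (e * h)"
      using e0 h by (intro mult_right_mono) (auto simp: c_def)
    also have "\<dots> = e * h powr a" using h by (simp add: powr_diff)
    finally have 2: "\<bar>integral {0..c} (\<lambda>t. ?k' t * integral {0..t} \<epsilon>)\<bar> \<le> e * h powr a" by simp
    have "\<bar>(x - c) powr (a - 1) * integral {0..c} \<epsilon>\<bar> \<le> h powr (a - 1) * (e * h)"
      using prim[of c] c by (simp add: abs_mult c_def mult_left_mono)
    also have "\<dots> = e * h powr a" using h by (simp add: powr_diff)
    finally have 1: "\<bar>(x - c) powr (a - 1) * integral {0..c} \<epsilon>\<bar> \<le> e * h powr a" .
    have 3: "\<bar>integral {c..x} (\<lambda>t. (x - t) powr (a - 1) * \<epsilon> t)\<bar> \<le> e * h powr a * (1 / a)"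
      using c by (intro near) (auto simp: c_def)
    have "(\<lambda>t. (x - t) powr (a - 1) * \<epsilon> t) integrable_on {0..x}"
      using integrable_subinterval_real[OF int, of 0 x] x bd a
      by (intro powr_kernel_mult_integrable[where M = e]) auto
    then have "integral {0..x} (\<lambda>t. (x - t) powr (a - 1) * \<epsilon> t) =
        integral {0..c} (\<lambda>t. (x - t) powr (a - 1) * \<epsilon> t) + integral {c..x} (\<lambda>t. (x - t) powr (a - 1) * \<epsilon> t)"
      using c by (intro Henstock_Kurzweil_Integration.integral_combine[symmetric]) auto
    then show ?thesis unfolding far using 1 2 3 by (simp add: algebra_simps)
  qed
qed

section \<open>Weak derivatives tested with smooth hat functions\<close>

text \<open>The powers of \<open>1 / x\<close> are carried along so that the family is closed under
  differentiation up to linear combinations. The member with \<open>i = 0\<close> is the classical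
  smooth function that is flat at 0.\<close>

definition flat_exp :: "nat \<Rightarrow> real \<Rightarrow> real" where
  "flat_exp i x = (if x \<le> 0 then 0 else inverse x ^ i * exp (- inverse x))"

lemma flat_exp_tendsto_0: "(flat_exp i \<longlongrightarrow> 0) (at 0)"
proof -
  have "((\<lambda>x::real. x ^ i / exp x) \<longlongrightarrow> 0) at_top"
    by (rule tendsto_power_div_exp_0)
  then have "((\<lambda>x::real. inverse x ^ i / exp (inverse x)) \<longlongrightarrow> 0) (at_right 0)"
    by (rule filterlim_compose[OF _ filterlim_inverse_at_top_right])
  moreover have "\<forall>\<^sub>F x in at_right 0. inverse x ^ i / exp (inverse x) = flat_exp i x"
    using eventually_at_right_less[of 0]
    by eventually_elim (simp add: flat_exp_def exp_minus divide_inverse)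
  ultimately have "(flat_exp i \<longlongrightarrow> 0) (at_right 0)"
    by (rule Lim_transform_eventually)
  moreover have "(flat_exp i \<longlongrightarrow> 0) (at_left 0)"
    by (rule tendsto_eventually, rule eventually_at_leftI[of "-1"])
       (auto simp: flat_exp_def)
  ultimately show ?thesis
    by (simp add: filterlim_split_at)
qed

lemma flat_exp_has_derivative:
  "(flat_exp i has_real_derivative (flat_exp (i + 2) x - real i * flat_exp (i + 1) x)) (at x)"
proof -
  consider "x < 0" | "x = 0" | "x > 0" by linarith
  then show ?thesis
  proof cases
    case 1
    have "((\<lambda>_. 0) has_real_derivative 0) (at x)" by simp
    then have "(flat_exp i has_real_derivative 0) (at x)"
      by (rule has_field_derivative_transform_within_open[of _ _ _ "{..<0}"])
         (use 1 in \<open>auto simp: flat_exp_def\<close>)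
    then show ?thesis using 1 by (simp add: flat_exp_def)
  next
    \<comment> \<open>At 0 the difference quotient of one member is the next member, so the limit
      already known for all indices is the derivative.\<close>
    case 2
    have "\<forall>\<^sub>F y in at 0. flat_exp (Suc i) y = (flat_exp i y - flat_exp i 0) / (y - 0)"
      by (rule eventually_mono[OF eventually_neq_at_within[of 0]])
         (auto simp: flat_exp_def field_simps)
    then have "((\<lambda>y. (flat_exp i y - flat_exp i 0) / (y - 0)) \<longlongrightarrow> 0) (at 0)"
      using flat_exp_tendsto_0[of "Suc i"] by (rule Lim_transform_eventually[rotated])
    then show ?thesis using 2
      by (simp add: has_field_derivative_iff flat_exp_def)
  next
    case 3
    have pow: "real i * inverse x ^ (i - Suc 0) = real i * (inverse x ^ i * x)"
      using 3 by (cases i) auto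
    have "((\<lambda>y. inverse y ^ i * exp (- inverse y)) has_real_derivative
        (real i * inverse x ^ (i - Suc 0)) * - (inverse x ^ 2) * exp (- inverse x)
        + inverse x ^ i * (exp (- inverse x) * inverse x ^ 2)) (at x)"
      using 3 by (auto intro!: derivative_eq_intros simp: power2_eq_square)
    then have "((\<lambda>y. inverse y ^ i * exp (- inverse y)) has_real_derivative
           (flat_exp (i + 2) x - real i * flat_exp (i + 1) x)) (at x)"
      unfolding pow using 3 by (rule_tac DERIV_cong) (auto simp: flat_exp_def field_simps power2_eq_square)
    then show ?thesis
      by (rule has_field_derivative_transform_within_open[of _ _ _ "{0<..}"])
         (use 3 in \<open>auto simp: flat_exp_def\<close>)
  qed
qed

lemma flat_exp_nonneg: "flat_exp i x \<ge> 0"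
  by (simp add: flat_exp_def)

text \<open>For negative \<open>x\<close> the interval \<open>{0..x}\<close> is empty and the
  integral is 0, which is consistent with \<open>f\<close> vanishing there. Moving the base point to
  -1 makes 0 an interior point, so that the derivative there is two-sided.\<close>

lemma has_derivative_integral_from_0:
  fixes f :: "real \<Rightarrow> real"
  assumes cont: "continuous_on UNIV f" and zero: "\<And>x. x \<le> 0 \<Longrightarrow> f x = 0"
  shows "((\<lambda>x. integral {0..x} f) has_real_derivative f x) (at x)"
proof (cases "x < 0")
  case True
  have "((\<lambda>_. 0) has_real_derivative 0) (at x)" by simp
  then have "((\<lambda>x. integral {0..x} f) has_real_derivative 0) (at x)"
    by (rule has_field_derivative_transform_within_open[of _ _ _ "{..<0}"]) (use True in auto)
  then show ?thesis using True zero by simp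
next
  case False
  have shift: "integral {-1..y} f = integral {0..y} f" if "y > -1" for y
  proof (cases "y \<ge> 0")
    case True
    have "(f has_integral 0) {-1..0}"
      by (rule has_integral_is_0) (use zero in auto)
    moreover have "integral {-1..0} f + integral {0..y} f = integral {-1..y} f"
      using True cont by (intro Henstock_Kurzweil_Integration.integral_combine
          integrable_continuous_real) (auto intro: continuous_on_subset)
    ultimately show ?thesis by (simp add: integral_unique)
  next
    case False
    have "integral {-1..y} f = integral {-1..y} (\<lambda>_. 0)"
      by (rule Henstock_Kurzweil_Integration.integral_cong) (use zero False in auto)
    then show ?thesis using False by simp
  qed
  have "((\<lambda>u. integral {-1..u} f) has_real_derivative f x) (at x within {-1..x+1})"
    using False cont by (intro integral_has_real_derivative) (auto intro: continuous_on_subset)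
  then have "((\<lambda>u. integral {-1..u} f) has_real_derivative f x) (at x)"
    using False by (subst (asm) at_within_interior) auto
  then show ?thesis
    by (rule has_field_derivative_transform_within_open[of _ _ _ "{-1<..}"])
       (use False shift in auto)
qed

text \<open>The normalised primitive of the standard bump on the unit interval: a smooth Heaviside
  function whose transition takes place between 0 and 1. Its own primitive
  \<open>smooth_ramp\<close> then serves as a smooth positive part.\<close>

definition smooth_step :: "real \<Rightarrow> real" where
  "smooth_step x = integral {0..x} (\<lambda>t. flat_exp 0 t * flat_exp 0 (1 - t)) /
     integral {0..1} (\<lambda>t. flat_exp 0 t * flat_exp 0 (1 - t))"

definition smooth_ramp :: "real \<Rightarrow> real" where
  "smooth_ramp x = integral {0..x} smooth_step"

lemma continuous_on_flat_exp [continuous_intros]: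
  assumes "continuous_on S f"
  shows "continuous_on S (\<lambda>x. flat_exp i (f x))"
proof -
  have "continuous_on UNIV (flat_exp i)"
    using flat_exp_has_derivative DERIV_isCont continuous_at_imp_continuous_on by blast
  then show ?thesis
    using continuous_on_compose2[OF _ assms] by blast
qed

lemma flat_exp_product_integral_pos:
  "integral {0..1} (\<lambda>t. flat_exp 0 t * flat_exp 0 (1 - t)) > 0"
proof -
  let ?\<beta> = "\<lambda>t. flat_exp 0 t * flat_exp 0 (1 - t)"
  have c: "continuous_on {0..1} ?\<beta>" by (intro continuous_intros)
  have "integral {0..1} ?\<beta> \<ge> 0"
    by (rule integral_nonneg) (auto intro!: integrable_continuous_real c mult_nonneg_nonneg flat_exp_nonneg)
  moreover have "integral {0..1} ?\<beta> \<noteq> 0"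
  proof
    assume "integral {0..1} ?\<beta> = 0"
    then have "\<forall>t\<in>{0..1}. ?\<beta> t = 0"
      by (subst (asm) integral_eq_0_iff[OF c]) (auto intro: mult_nonneg_nonneg flat_exp_nonneg)
    from bspec[OF this, of "1/2"] show False by (simp add: flat_exp_def)
  qed
  ultimately show ?thesis by linarith
qed

lemma smooth_step_has_derivative:
  "(smooth_step has_real_derivative flat_exp 0 x * flat_exp 0 (1 - x) /
     integral {0..1} (\<lambda>t. flat_exp 0 t * flat_exp 0 (1 - t))) (at x)"
  unfolding smooth_step_def
  by (rule DERIV_cdivide, rule has_derivative_integral_from_0, intro continuous_intros)
     (auto simp: flat_exp_def)

lemma continuous_on_smooth_step: "continuous_on UNIV smooth_step"
  using smooth_step_has_derivative DERIV_isCont continuous_at_imp_continuous_on by blast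

lemma smooth_step_eq_0: "x \<le> 0 \<Longrightarrow> smooth_step x = 0"
  by (cases "x = 0") (auto simp: smooth_step_def)

lemma smooth_step_mono: "x \<le> y \<Longrightarrow> smooth_step x \<le> smooth_step y"
  by (rule DERIV_nonneg_imp_nondecreasing)
     (use smooth_step_has_derivative flat_exp_product_integral_pos in
       \<open>auto intro!: exI divide_nonneg_pos mult_nonneg_nonneg flat_exp_nonneg\<close>)

lemma smooth_step_eq_1:
  assumes "x \<ge> 1" shows "smooth_step x = 1"
proof -
  let ?\<beta> = "\<lambda>t. flat_exp 0 t * flat_exp 0 (1 - t)"
  have "integral {0..1} ?\<beta> + integral {1..x} ?\<beta> = integral {0..x} ?\<beta>"
    using assms by (intro Henstock_Kurzweil_Integration.integral_combine
          integrable_continuous_real continuous_intros) auto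
  moreover have "integral {1..x} ?\<beta> = integral {1..x} (\<lambda>_. 0)"
    by (rule Henstock_Kurzweil_Integration.integral_cong) (auto simp: flat_exp_def)
  ultimately show ?thesis using flat_exp_product_integral_pos by (simp add: smooth_step_def)
qed

lemma smooth_step_bounds: "0 \<le> smooth_step x" "smooth_step x \<le> 1"
  using smooth_step_mono[of "min x 0" x] smooth_step_mono[of x "max x 1"]
  by (auto simp: smooth_step_eq_0 smooth_step_eq_1)

lemma smooth_ramp_has_derivative: "(smooth_ramp has_real_derivative smooth_step x) (at x)"
  unfolding smooth_ramp_def
  by (rule has_derivative_integral_from_0) (auto intro: continuous_on_smooth_step smooth_step_eq_0)

lemma smooth_ramp_eq_0: "x \<le> 0 \<Longrightarrow> smooth_ramp x = 0"
  by (cases "x = 0") (auto simp: smooth_ramp_def)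

lemma smooth_ramp_ge_1:
  assumes "x \<ge> 1" shows "smooth_ramp x = smooth_ramp 1 + (x - 1)"
proof -
  have "integral {0..1} smooth_step + integral {1..x} smooth_step = integral {0..x} smooth_step"
    using assms by (intro Henstock_Kurzweil_Integration.integral_combine
          integrable_continuous_real continuous_on_subset[OF continuous_on_smooth_step]) auto
  moreover have "integral {1..x} smooth_step = integral {1..x} (\<lambda>_. 1)"
    by (rule Henstock_Kurzweil_Integration.integral_cong) (auto simp: smooth_step_eq_1)
  ultimately show ?thesis using assms by (simp add: smooth_ramp_def)
qed

text \<open>Replacing \<open>x\<close> by \<open>n * x\<close> and dividing by \<open>n\<close>
  turns this into a uniform error \<open>1 / n\<close> in the approximation of the positive
  part.\<close>

lemma smooth_ramp_close: "\<bar>smooth_ramp x - max x 0\<bar> \<le> 1"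
proof -
  have *: "0 \<le> smooth_ramp y \<and> smooth_ramp y \<le> y" if "y \<ge> 0" for y
  proof
    have i: "smooth_step integrable_on {0..y}"
      by (intro integrable_continuous_real continuous_on_subset[OF continuous_on_smooth_step]) auto
    show "0 \<le> smooth_ramp y"
      unfolding smooth_ramp_def by (rule integral_nonneg[OF i]) (auto simp: smooth_step_bounds)
    have "integral {0..y} smooth_step \<le> integral {0..y} (\<lambda>_. 1)"
      by (rule integral_le[OF i]) (auto simp: smooth_step_bounds)
    then show "smooth_ramp y \<le> y" using that by (simp add: smooth_ramp_def)
  qed
  consider "x \<le> 0" | "0 \<le> x" "x \<le> 1" | "x \<ge> 1" by linarith
  then show ?thesis
  proof cases
    case 3
    then show ?thesis using *[of 1] smooth_ramp_ge_1[of x] by auto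
  qed (use *[of x] smooth_ramp_eq_0 in auto)
qed

text \<open>\<open>test_fun\<close> asks for differentiability of every iterated
  \<open>deriv\<close>. A class closed under differentiation by construction reduces this to a
  single structural induction. The bumps need two free indices because the product rule raises the
  index of either factor.\<close>

inductive_set smooth_functions :: "(real \<Rightarrow> real) set" where
  bump: "(\<lambda>x. flat_exp i x * flat_exp j (1 - x)) \<in> smooth_functions"
| step: "smooth_step \<in> smooth_functions"
| ramp: "smooth_ramp \<in> smooth_functions"
| affine: "f \<in> smooth_functions \<Longrightarrow> (\<lambda>x. c * f (a * x + b)) \<in> smooth_functions"
| add: "f \<in> smooth_functions \<Longrightarrow> g \<in> smooth_functions \<Longrightarrow> (\<lambda>x. f x + g x) \<in> smooth_functions"

lemma smooth_functions_scale: "f \<in> smooth_functions \<Longrightarrow> (\<lambda>x. c * f x) \<in> smooth_functions"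
  using smooth_functions.affine[of f c 1 0] by simp

lemma smooth_functions_derivative:
  assumes "f \<in> smooth_functions"
  shows "\<exists>f'\<in>smooth_functions. \<forall>x. (f has_real_derivative f' x) (at x)"
  using assms
proof induction
  case (bump i j)
  let ?b = "\<lambda>i j x. flat_exp i x * flat_exp j (1 - x)"
  let ?f' = "\<lambda>x. (?b (i+2) j x + (- real i) * ?b (i+1) j x) +
     ((-1) * ?b i (j+2) x + real j * ?b i (j+1) x)"
  have "?f' \<in> smooth_functions"
    by (intro smooth_functions.add smooth_functions_scale smooth_functions.bump)
  moreover have "((\<lambda>x. ?b i j x) has_real_derivative ?f' x) (at x)" for x
  proof -
    have "((\<lambda>x. flat_exp j (1 - x)) has_real_derivative
        (flat_exp (j + 2) (1 - x) - real j * flat_exp (j + 1) (1 - x)) * (- 1)) (at x)"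
      by (rule DERIV_chain2[OF flat_exp_has_derivative]) (auto intro!: derivative_eq_intros)
    from DERIV_mult[OF flat_exp_has_derivative[of i x] this] show ?thesis
      by (rule DERIV_cong) (simp add: algebra_simps)
  qed
  ultimately show ?case by (intro bexI[of _ ?f'] allI) 
next
  case step
  have "(\<lambda>x. (1 / integral {0..1} (\<lambda>t. flat_exp 0 t * flat_exp 0 (1 - t))) *
      (flat_exp 0 x * flat_exp 0 (1 - x))) \<in> smooth_functions"
    by (intro smooth_functions_scale smooth_functions.bump)
  then show ?case using smooth_step_has_derivative by (auto intro!: bexI[rotated])
next
  case ramp
  then show ?case using smooth_functions.step smooth_ramp_has_derivative by blast
next
  case (affine f c a b)
  then obtain f' where f': "f' \<in> smooth_functions" "\<And>x. (f has_real_derivative f' x) (at x)"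
    by blast
  have "((\<lambda>x. c * f (a * x + b)) has_real_derivative (c * a) * f' (a * x + b)) (at x)" for x
  proof -
    have "((\<lambda>x. f (a * x + b)) has_real_derivative f' (a * x + b) * a) (at x)"
      by (rule DERIV_chain2[OF f'(2)]) (auto intro!: derivative_eq_intros)
    from DERIV_cmult[OF this, of c] show ?thesis by (simp add: mult_ac)
  qed
  moreover have "(\<lambda>x. (c * a) * f' (a * x + b)) \<in> smooth_functions"
    using f'(1) by (rule smooth_functions.affine)
  ultimately show ?case by (intro bexI[of _ "\<lambda>x. (c * a) * f' (a * x + b)"] allI)
next
  case (add f g)
  then obtain f' g' where "f' \<in> smooth_functions" "\<And>x. (f has_real_derivative f' x) (at x)"
    "g' \<in> smooth_functions" "\<And>x. (g has_real_derivative g' x) (at x)"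
    by blast
  then show ?case
    by (intro bexI[of _ "\<lambda>x. f' x + g' x"]) (auto intro!: DERIV_add smooth_functions.add)
qed

lemma smooth_functions_higher_differentiable:
  assumes "f \<in> smooth_functions"
  shows "((deriv ^^ n) f) differentiable (at x)"
proof -
  have "(deriv ^^ n) f \<in> smooth_functions"
  proof (induction n)
    case (Suc n)
    then obtain f' where "f' \<in> smooth_functions"
      "\<And>x. ((deriv ^^ n) f has_real_derivative f' x) (at x)"
      using smooth_functions_derivative by blast
    then have "deriv ((deriv ^^ n) f) = f'" by (auto intro: DERIV_imp_deriv)
    then show ?case using \<open>f' \<in> smooth_functions\<close> by simp
  qed (use assms in simp)
  then show ?thesis
    using smooth_functions_derivative real_differentiable_def by blast
qed

section \<open>Passage from smooth steps to jumps\<close>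

lemma smooth_step_tendsto:
  "(\<lambda>n. smooth_step (real (Suc n) * s)) \<longlonglongrightarrow> (if s > 0 then 1 else 0)"
proof (cases "s > 0")
  case True
  obtain m where m: "1 / s < real m" using reals_Archimedean2 by blast
  have "\<forall>\<^sub>F n in sequentially. smooth_step (real (Suc n) * s) = 1"
    using eventually_ge_at_top[of m]
  proof eventually_elim
    case (elim n)
    then have "1 / s \<le> real (Suc n)" using m by simp
    then have "1 \<le> real (Suc n) * s" using True by (simp add: field_simps)
    then show ?case by (rule smooth_step_eq_1)
  qed
  then show ?thesis using True by (simp add: tendsto_eventually)
next
  case False
  then have "smooth_step (real (Suc n) * s) = 0" for n
    by (intro smooth_step_eq_0) (simp add: mult_nonneg_nonpos)
  then show ?thesis using False by simp
qed

lemma integral_smooth_step_tendsto: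
  fixes f :: "real \<Rightarrow> real"
  assumes f: "f integrable_on {0..1}" and bd: "\<And>t. t \<in> {0..1} \<Longrightarrow> \<bar>f t\<bar> \<le> M"
    and a: "0 \<le> a" "a \<le> 1"
  shows "(\<lambda>t. smooth_step (c * (t - a)) * f t) integrable_on {0..1}"
    and "(\<lambda>n. integral {0..1} (\<lambda>t. smooth_step (real (Suc n) * (t - a)) * f t))
           \<longlonglongrightarrow> integral {a..1} f"
proof -
  have int: "(\<lambda>t. smooth_step (c * (t - a)) * f t) integrable_on {0..1}" for c
    by (intro set_lebesgue_integral_eq_integral(1)
        absolutely_integrable_mult_bounded[OF f bd] absolutely_integrable_continuous_real
        continuous_on_compose2[OF continuous_on_smooth_step] continuous_intros) auto
  then show "(\<lambda>t. smooth_step (c * (t - a)) * f t) integrable_on {0..1}" .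
  have "(\<lambda>n. integral {0..1} (\<lambda>t. smooth_step (real (Suc n) * (t - a)) * f t))
      \<longlonglongrightarrow> integral {0..1} (\<lambda>t. (if t - a > 0 then 1 else 0) * f t)"
  proof (rule dominated_convergence(2)[where h = "\<lambda>_. M"])
    show "norm (smooth_step (real (Suc k) * (t - a)) * f t) \<le> M" if "t \<in> {0..1}" for k t
      using mult_mono[OF smooth_step_bounds(2) bd[OF that], of "real (Suc k) * (t - a)"]
      by (simp add: abs_mult smooth_step_bounds)
    show "(\<lambda>k. smooth_step (real (Suc k) * (t - a)) * f t)
        \<longlonglongrightarrow> (if t - a > 0 then 1 else 0) * f t" for t
      by (intro tendsto_mult smooth_step_tendsto tendsto_const)
  qed (use int in auto)
  also have "integral {0..1} (\<lambda>t. (if t - a > 0 then 1 else 0) * f t) =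
      integral {0..1} (\<lambda>t. if t \<in> {a..1} then f t else 0)"
    by (rule integral_spike[of "{a}"]) auto
  also have "\<dots> = integral {a..1} f"
    using a by (subst integral_restrict_Int) (simp add: Int_absorb1)
  finally show "(\<lambda>n. integral {0..1} (\<lambda>t. smooth_step (real (Suc n) * (t - a)) * f t))
           \<longlonglongrightarrow> integral {a..1} f" .
qed

text \<open>Testing the weak derivative with smoothed hat functions peaked at \<open>x\<close> and supported near
  \<open>{a..b}\<close> compares the average slopes of the primitive of \<open>f\<close> on both sides of \<open>x\<close>.\<close>

lemma weak_deriv_hat_bound:
  fixes f g :: "real \<Rightarrow> real"
  assumes f: "f integrable_on {0..1}" and fM: "\<And>t. t \<in> {0..1} \<Longrightarrow> \<bar>f t\<bar> \<le> M\<^sub>0"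
    and gM: "\<And>t. t \<in> {0..1} \<Longrightarrow> \<bar>g t\<bar> \<le> M" and wd: "weak_deriv f g"
    and ord: "0 < a" "a < x" "x < b" "b < 1"
  shows "\<bar>integral {a..1} f / (x - a) - (1 / (x - a) + 1 / (b - x)) * integral {x..1} f
           + integral {b..1} f / (b - x)\<bar> \<le> M * (b - a)"
proof -
  define A where "A = 1 / (x - a)"
  define B where "B = 1 / (b - x)"
  have pos: "A > 0" "B > 0" using ord by (auto simp: A_def B_def)
  let ?s = "\<lambda>n. real (Suc n)"
  \<comment> \<open>A smoothed hat of height 1 over \<open>{a..b}\<close> with peak at
    \<open>x\<close>, rising with slope \<open>A\<close> and falling with slope \<open>B\<close>.
    The weights \<open>A\<close>, \<open>- (A + B)\<close> and \<open>B\<close> are the jumps of the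
    slope at the three kinks, each positive part being replaced by a rescaled ramp.\<close>
  define \<phi> where "\<phi> = (\<lambda>n t. A / ?s n * smooth_ramp (?s n * t + - ?s n * a) +
     (- (A + B) / ?s n * smooth_ramp (?s n * t + - ?s n * x) +
      B / ?s n * smooth_ramp (?s n * t + - ?s n * b)))"
  define \<phi>' where "\<phi>' = (\<lambda>n t. A * smooth_step (?s n * (t - a)) -
     (A + B) * smooth_step (?s n * (t - x)) + B * smooth_step (?s n * (t - b)))"
  have smooth: "\<phi> n \<in> smooth_functions" for n
    unfolding \<phi>_def
    by (intro smooth_functions.add smooth_functions.affine smooth_functions.ramp)
  have der: "(\<phi> n has_real_derivative \<phi>' n t) (at t)" for n t
  proof -
    have 1: "((\<lambda>t. c / ?s n * smooth_ramp (?s n * t + - ?s n * d)) has_real_derivative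
        c * smooth_step (?s n * (t - d))) (at t)" for c d
    proof -
      have "((\<lambda>t. smooth_ramp (?s n * t + - ?s n * d)) has_real_derivative
          smooth_step (?s n * t + - ?s n * d) * ?s n) (at t)"
        by (rule DERIV_chain2[OF smooth_ramp_has_derivative]) (auto intro!: derivative_eq_intros)
      from DERIV_cmult[OF this, of "c / ?s n"]
      show ?thesis by (rule DERIV_cong) (simp add: algebra_simps del: of_nat_Suc)
    qed
    show ?thesis unfolding \<phi>_def \<phi>'_def
      by (rule DERIV_cong[OF DERIV_add[OF 1 DERIV_add[OF 1 1]]]) (simp add: algebra_simps)
  qed
  have left0: "\<phi> n t = 0" if "t \<le> a" for n t
  proof -
    have "smooth_ramp (?s n * t + - ?s n * d) = 0" if "d \<ge> a" for d
    proof -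
      have "?s n * (t - d) \<le> 0" using that \<open>t \<le> a\<close> by (intro mult_nonneg_nonpos) auto
      then show ?thesis by (intro smooth_ramp_eq_0) (simp add: algebra_simps del: of_nat_Suc)
    qed
    then show ?thesis using ord by (simp add: \<phi>_def del: of_nat_Suc)
  qed
  \<comment> \<open>A ramp becomes straight only at distance \<open>1 / ?s n\<close> after its kink,
    so the support reaches that far beyond \<open>b\<close>. From there on the common offset
    \<open>r\<close> cancels because the weights sum to 0, and the rest cancels because
    \<open>A * (x - a)\<close> and \<open>B * (b - x)\<close> are both 1.\<close>
  have right0: "\<phi> n t = 0" if t: "t \<ge> b + 1 / ?s n" for n t
  proof -
    define r where "r = (smooth_ramp 1 - 1) / ?s n"
    have *: "c / ?s n * smooth_ramp (?s n * t + - ?s n * d) = c * (r + t - d)" if "d \<le> b" for c d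
    proof -
      have "1 \<le> ?s n * (t - b)" using t by (simp add: field_simps del: of_nat_Suc)
      also have "\<dots> \<le> ?s n * (t - d)" using that by (intro mult_left_mono) auto
      finally have "smooth_ramp (?s n * t + - ?s n * d) = smooth_ramp 1 + (?s n * t + - ?s n * d - 1)"
        by (intro smooth_ramp_ge_1) (simp add: algebra_simps del: of_nat_Suc)
      then have "c / ?s n * smooth_ramp (?s n * t + - ?s n * d) =
          c / ?s n * (smooth_ramp 1 + (?s n * t + - ?s n * d - 1))" by (simp only:)
      also have "\<dots> = c * (r + t - d)"
        by (simp add: r_def field_simps del: of_nat_Suc)
      finally show ?thesis .
    qed
    have "\<phi> n t = A * (x - a) - B * (b - x)"
      unfolding \<phi>_def using ord by (subst (1 2 3) *) (auto simp: algebra_simps)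
    then show ?thesis using ord by (simp add: A_def B_def)
  qed
  have bound: "\<bar>\<phi> n t\<bar> \<le> 1 + 2 * (A + B) / ?s n" for n t
  proof -
    \<comment> \<open>\<open>r d\<close> is the error of one rescaled ramp against its positive
      part. The absolute weights add up to \<open>2 * (A + B)\<close>, whence the excess over the
      height 1 of the hat.\<close>
    define r where "r = (\<lambda>d. smooth_ramp (?s n * t + - ?s n * d) / ?s n - max (t - d) 0)"
    have r: "\<bar>r d\<bar> \<le> 1 / ?s n" for d
    proof -
      have "max (?s n * t + - ?s n * d) 0 = ?s n * max (t - d) 0"
        by (simp add: max_mult_distrib_left algebra_simps del: of_nat_Suc)
      then have "r d = (smooth_ramp (?s n * t + - ?s n * d) - max (?s n * t + - ?s n * d) 0) / ?s n"
        by (simp add: r_def field_simps del: of_nat_Suc)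
      then show ?thesis using smooth_ramp_close[of "?s n * t + - ?s n * d"]
        by (simp add: abs_divide divide_right_mono del: of_nat_Suc)
    qed
    let ?hat = "A * max (t - a) 0 - (A + B) * max (t - x) 0 + B * max (t - b) 0"
    have eq: "\<phi> n t = ?hat + (A * r a - (A + B) * r x + B * r b)"
      by (simp add: \<phi>_def r_def algebra_simps add_divide_distrib diff_divide_distrib del: of_nat_Suc)
    have hat: "0 \<le> ?hat \<and> ?hat \<le> 1"
    proof -
      have Ax: "A * (x - a) = 1" "B * (b - x) = 1" using ord by (auto simp: A_def B_def)
      consider "t \<le> a" | "a \<le> t" "t \<le> x" | "x \<le> t" "t \<le> b" | "b \<le> t" by linarith
      then show ?thesis
      proof cases
        case 2
        then have "A * (t - a) \<le> A * (x - a)" "0 \<le> A * (t - a)" using pos by auto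
        then show ?thesis using 2 ord Ax by simp
      next
        case 3
        then have "B * (b - t) \<le> B * (b - x)" "0 \<le> B * (b - t)" using pos by auto
        moreover have "?hat = B * (b - t)" using 3 ord Ax by (simp add: algebra_simps)
        ultimately show ?thesis using Ax by simp
      next
        case 4
        then have "?hat = 0" using ord Ax by (simp add: algebra_simps)
        then show ?thesis by simp
      qed (use ord in auto)
    qed
    have "\<bar>A * r a - (A + B) * r x + B * r b\<bar> \<le> A * \<bar>r a\<bar> + (A + B) * \<bar>r x\<bar> + B * \<bar>r b\<bar>"
    proof -
      have "\<bar>A * r a - (A + B) * r x + B * r b\<bar> \<le> \<bar>A * r a\<bar> + \<bar>(A + B) * r x\<bar> + \<bar>B * r b\<bar>"
        by linarith
      then show ?thesis using pos by (simp add: abs_mult)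
    qed
    also have "\<dots> \<le> A * (1 / ?s n) + (A + B) * (1 / ?s n) + B * (1 / ?s n)"
      using pos r by (intro add_mono mult_left_mono) auto
    also have "\<dots> = 2 * (A + B) / ?s n" by (simp add: field_simps del: of_nat_Suc)
    finally show ?thesis unfolding eq using hat by linarith
  qed
  have M0: "M \<ge> 0" using gM[of 0] by (smt (verit) atLeastAtMost_iff)
  \<comment> \<open>From \<open>m\<close> on, \<open>b + 1 / ?s n\<close> lies below 1, so that
    \<open>\<phi> n\<close> is supported well inside the unit interval and is admissible.
    Integrating over this support only is what produces the factor tending to
    \<open>b - a\<close>.\<close>
  obtain m where m: "1 / (1 - b) < real m" using reals_Archimedean2 by blast
  have "\<bar>integral {0..1} (\<lambda>t. f t * \<phi>' n t)\<bar> \<le> M * (1 + 2 * (A + B) / ?s n) * (b + 1 / ?s n - a)"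
    if n: "n \<ge> m" for n
  proof -
    have "1 / (1 - b) < ?s n" using m n by linarith
    then have b1: "b + 1 / ?s n < 1" using ord by (simp add: field_simps del: of_nat_Suc)
    have test: "test_fun (\<phi> n)"
      unfolding test_fun_def using smooth_functions_higher_differentiable[OF smooth] b1 ord left0 right0
      by (smt (verit, ccfv_SIG) atLeastAtMost_iff)
    have "integral {0..1} (\<lambda>t. f t * \<phi>' n t) = - integral {0..1} (\<lambda>t. g t * \<phi> n t)"
      using wd[unfolded weak_deriv_def, rule_format, OF test] DERIV_imp_deriv[OF der] by simp
    moreover have "integral {0..1} (\<lambda>t. g t * \<phi> n t) = integral {a..b + 1 / ?s n} (\<lambda>t. g t * \<phi> n t)"
    proof -
      have "(if t \<in> {0..1} then g t * \<phi> n t else 0) =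
          (if t \<in> {a..b + 1 / ?s n} then g t * \<phi> n t else 0)" for t
        using left0[of t n] right0[of n t] b1 ord by auto
      then show ?thesis
        by (subst (1 2) integral_restrict_UNIV[symmetric]) (simp del: of_nat_Suc)
    qed
    moreover have "\<bar>integral {a..b + 1 / ?s n} (\<lambda>t. g t * \<phi> n t)\<bar> \<le>
        M * (1 + 2 * (A + B) / ?s n) * (b + 1 / ?s n - a)"
    proof (rule abs_integral_le_bound)
      show "a \<le> b + 1 / ?s n" using ord by (smt (verit) divide_nonneg_nonneg of_nat_0_le_iff)
      show "\<bar>g t * \<phi> n t\<bar> \<le> M * (1 + 2 * (A + B) / ?s n)" if "t \<in> {a..b + 1 / ?s n}" for t
        using that gM[of t] bound[of n t] b1 ord M0 by (auto simp: abs_mult intro!: mult_mono)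
    qed
    ultimately show ?thesis by simp
  qed
  then have ev: "\<forall>\<^sub>F n in sequentially. \<bar>integral {0..1} (\<lambda>t. f t * \<phi>' n t)\<bar> \<le>
      M * (1 + 2 * (A + B) / ?s n) * (b + 1 / ?s n - a)"
    by (auto simp: eventually_sequentially)
  have "integral {0..1} (\<lambda>t. f t * \<phi>' n t) =
      A * integral {0..1} (\<lambda>t. smooth_step (?s n * (t - a)) * f t) -
      (A + B) * integral {0..1} (\<lambda>t. smooth_step (?s n * (t - x)) * f t) +
      B * integral {0..1} (\<lambda>t. smooth_step (?s n * (t - b)) * f t)" for n
  proof -
    have "(\<lambda>t. f t * \<phi>' n t) = (\<lambda>t. A * (smooth_step (?s n * (t - a)) * f t) -
      (A + B) * (smooth_step (?s n * (t - x)) * f t) + B * (smooth_step (?s n * (t - b)) * f t))"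
      by (auto simp: \<phi>'_def algebra_simps)
    then show ?thesis
      using integral_smooth_step_tendsto(1)[OF f fM] ord
      by (simp add: integral_add integral_diff integrable_on_mult_right integrable_diff del: of_nat_Suc)
  qed
  then have lim: "(\<lambda>n. integral {0..1} (\<lambda>t. f t * \<phi>' n t)) \<longlonglongrightarrow>
      A * integral {a..1} f - (A + B) * integral {x..1} f + B * integral {b..1} f"
    using ord by (auto simp del: of_nat_Suc intro!: tendsto_intros integral_smooth_step_tendsto(2)[OF f fM])
  have "(\<lambda>n. M * (1 + 2 * (A + B) * (1 / ?s n)) * (b + 1 / ?s n - a)) \<longlonglongrightarrow> M * (1 + 2 * (A + B) * 0) * (b + 0 - a)"
    by (intro tendsto_intros LIMSEQ_Suc[OF lim_1_over_n])
  then have "(\<lambda>n. M * (1 + 2 * (A + B) / ?s n) * (b + 1 / ?s n - a)) \<longlonglongrightarrow> M * (b - a)" by simp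
  from tendsto_le[OF _ this tendsto_rabs[OF lim] ev]
  show ?thesis by (simp add: A_def B_def)
qed

text \<open>Test functions vanish near 0 and 1, so hats reach only intervals strictly inside. The
  ends are included by contracting \<open>{a..b}\<close> slightly towards \<open>x\<close> and
  letting the contraction tend to none, using that \<open>F\<close> is continuous. Multiplying by
  \<open>(x - a) * (b - x)\<close> clears the denominators of the slopes.\<close>

lemma weak_deriv_second_difference:
  fixes f g :: "real \<Rightarrow> real"
  defines "F \<equiv> \<lambda>t. integral {0..t} f"
  assumes f: "f integrable_on {0..1}" and fM: "\<And>t. t \<in> {0..1} \<Longrightarrow> \<bar>f t\<bar> \<le> M\<^sub>0"
    and gM: "\<And>t. t \<in> {0..1} \<Longrightarrow> \<bar>g t\<bar> \<le> M" and wd: "weak_deriv f g"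
    and ord: "0 \<le> a" "a < x" "x < b" "b \<le> 1"
  shows "\<bar>(F x - F a) * (b - x) - (F b - F x) * (x - a)\<bar> \<le> M * (b - a) * (x - a) * (b - x)"
proof -
  have contF: "continuous_on {0..1} F"
    unfolding F_def by (rule indefinite_integral_continuous_1[OF f])
  have inner: "\<bar>(F x - F a) * (b - x) - (F b - F x) * (x - a)\<bar> \<le> M * (b - a) * (x - a) * (b - x)"
    if o: "0 < a" "a < x" "x < b" "b < 1" for a b
  proof -
    have tail: "integral {y..1} f = F 1 - F y" if "0 \<le> y" "y \<le> 1" for y
      using Henstock_Kurzweil_Integration.integral_combine[OF that f] by (simp add: F_def)
    have "integral {a..1} f / (x - a) - (1 / (x - a) + 1 / (b - x)) * integral {x..1} f
           + integral {b..1} f / (b - x) =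
        ((F x - F a) * (b - x) - (F b - F x) * (x - a)) / ((x - a) * (b - x))"
      using o by (simp add: tail divide_simps) (simp add: algebra_simps)
    with weak_deriv_hat_bound[OF f fM gM wd o]
    have "\<bar>((F x - F a) * (b - x) - (F b - F x) * (x - a)) / ((x - a) * (b - x))\<bar> \<le> M * (b - a)"
      by simp
    then show ?thesis using o by (simp add: abs_divide abs_mult pos_divide_le_eq mult.assoc)
  qed
  let ?a = "\<lambda>e. a + e * (x - a)" and ?b = "\<lambda>e. b - e * (b - x)"
  have ta: "(?a \<longlongrightarrow> a) (at_right 0)" and tb: "(?b \<longlongrightarrow> b) (at_right 0)"
    by (auto intro!: tendsto_eq_intros)
  have inside: "0 < ?a e \<and> ?a e < x \<and> x < ?b e \<and> ?b e < 1" if "0 < e" "e < 1" for e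
  proof -
    define p q where "p = e * (x - a)" and "q = e * (b - x)"
    have "0 < p" "p < 1 * (x - a)" "0 < q" "q < 1 * (b - x)"
      unfolding p_def q_def using that ord by (auto intro!: mult_strict_right_mono)
    then show ?thesis unfolding p_def[symmetric] q_def[symmetric] using ord by auto
  qed
  have in01: "?a e \<in> {0..1}" "?b e \<in> {0..1}" if "0 < e" "e < 1" for e
    using inside[OF that] ord by (auto simp del: diff_le_eq)
  have ev: "\<forall>\<^sub>F e in at_right 0. 0 < e \<and> e < (1::real)"
    by (auto simp: eventually_at_right_field intro!: exI[of _ 1])
  have tF: "((\<lambda>e. F (c e)) \<longlongrightarrow> F y) (at_right 0)"
    if "(c \<longlongrightarrow> y) (at_right 0)" "y \<in> {0..1}" "\<And>e. 0 < e \<Longrightarrow> e < 1 \<Longrightarrow> c e \<in> {0..1}" for c :: "real \<Rightarrow> real" and y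
    by (rule continuous_on_tendsto_compose[OF contF that(1,2)])
       (use that(3) ev in \<open>auto elim: eventually_mono\<close>)
  have tFa: "((\<lambda>e. F (?a e)) \<longlongrightarrow> F a) (at_right 0)"
    by (rule tF[OF ta]) (use in01 ord in auto)
  have tFb: "((\<lambda>e. F (?b e)) \<longlongrightarrow> F b) (at_right 0)"
    by (rule tF[OF tb]) (use in01 ord in auto)
  show ?thesis
  proof (rule tendsto_le)
    show "((\<lambda>e. M * (?b e - ?a e) * (x - ?a e) * (?b e - x)) \<longlongrightarrow> M * (b - a) * (x - a) * (b - x)) (at_right 0)"
      by (intro tendsto_intros ta tb)
    show "((\<lambda>e. \<bar>(F x - F (?a e)) * (?b e - x) - (F (?b e) - F x) * (x - ?a e)\<bar>) \<longlongrightarrow>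
       \<bar>(F x - F a) * (b - x) - (F b - F x) * (x - a)\<bar>) (at_right 0)"
      by (intro tendsto_intros ta tb tFa tFb)
    show "\<forall>\<^sub>F e in at_right 0. \<bar>(F x - F (?a e)) * (?b e - x) - (F (?b e) - F x) * (x - ?a e)\<bar>
       \<le> M * (?b e - ?a e) * (x - ?a e) * (?b e - x)"
      using ev by eventually_elim (rule inner; use inside in blast)
  qed simp
qed

text \<open>The error of linear interpolation times \<open>b - a\<close> is precisely the weighted
  second difference. This replaces the Taylor estimate for a function with bounded second
  derivative, which \<open>F\<close> has only in the weak sense.\<close>

lemma weak_deriv_primitive_interpolation:
  fixes f g :: "real \<Rightarrow> real"
  defines "F \<equiv> \<lambda>t. integral {0..t} f"
  assumes f: "f integrable_on {0..1}" and fM: "\<And>t. t \<in> {0..1} \<Longrightarrow> \<bar>f t\<bar> \<le> M\<^sub>0"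
    and gM: "\<And>t. t \<in> {0..1} \<Longrightarrow> \<bar>g t\<bar> \<le> M" and wd: "weak_deriv f g"
    and ord: "0 \<le> a" "a < b" "b \<le> 1" and x: "x \<in> {a..b}"
  shows "\<bar>F x - (F a + (F b - F a) / (b - a) * (x - a))\<bar> \<le> M * (b - a)\<^sup>2"
proof -
  have M0: "M \<ge> 0" using gM[of 0] by (smt (verit) atLeastAtMost_iff)
  consider "x = a" | "x = b" | "a < x" "x < b" using x by force
  then show ?thesis
  proof cases
    case 3
    let ?d = "F x - (F a + (F b - F a) / (b - a) * (x - a))"
    have "?d * (b - a) = (F x - F a) * (b - x) - (F b - F x) * (x - a)"
      using ord by (simp add: field_simps)
    then have "\<bar>?d\<bar> * (b - a) \<le> M * (b - a) * (x - a) * (b - x)"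
      using weak_deriv_second_difference[OF f fM gM wd ord(1) 3 ord(3)] ord
      by (simp add: F_def abs_mult_pos)
    also have "\<dots> \<le> M * (b - a) * (b - a) * (b - a)"
      using 3 M0 by (intro mult_mono mult_nonneg_nonneg) auto
    finally show ?thesis using ord by (simp add: power2_eq_square)
  qed (use ord M0 in auto)
qed

section \<open>Element-wise orthogonality and the Galerkin error\<close>

lemma abs_integral_le_bound_finite:
  fixes f :: "real \<Rightarrow> real"
  assumes "a \<le> b" and "finite S" and "0 \<le> M" and "\<And>t. t \<in> {a..b} - S \<Longrightarrow> \<bar>f t\<bar> \<le> M"
  shows "\<bar>integral {a..b} f\<bar> \<le> M * (b - a)"
proof -
  have "integral {a..b} f = integral {a..b} (\<lambda>t. if t \<in> S then 0 else f t)"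
    by (rule integral_spike[OF negligible_finite[OF \<open>finite S\<close>]]) auto
  also have "\<bar>\<dots>\<bar> \<le> M * (b - a)"
    by (rule abs_integral_le_bound[OF \<open>a \<le> b\<close>]) (use assms in auto)
  finally show ?thesis .
qed

section \<open>Partitions and derivatives of finite element functions\<close>

lemma partition_mono:
  assumes "is_partition N p" "i \<le> j" "j \<le> N"
  shows "p i \<le> p j"
  using assms(2,3)
proof (induction j rule: dec_induct)
  case (step n)
  then have "p n < p (Suc n)" using assms(1) by (simp add: is_partition_def)
  then show ?case using step by simp
qed simp

lemma partition_in_unit_interval:
  assumes "is_partition N p" "i \<le> N"
  shows "0 \<le> p i" "p i \<le> 1"
  using partition_mono[OF assms(1), of 0 i] partition_mono[OF assms(1), of i N] assms
  by (auto simp: is_partition_def)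

lemma partition_step_le_mesh:
  "i < N \<Longrightarrow> p (Suc i) - p i \<le> mesh N p"
  unfolding mesh_def by (rule Max_ge) auto

lemma partition_cover:
  assumes "is_partition N p" "t \<in> {0..1}"
  obtains i where "i < N" "t \<in> {p i..p (Suc i)}"
proof -
  have "\<exists>i<n. t \<in> {p i..p (Suc i)}" if "n \<le> N" "t \<in> {0..p n}" "1 \<le> n" for n
    using that
  proof (induction n)
    case (Suc n)
    show ?case
    proof (cases "n \<ge> 1 \<and> t \<le> p n")
      case True
      then show ?thesis using Suc by (auto intro: less_SucI)
    next
      case False
      then have "p n \<le> t" using Suc assms(1) by (cases "n = 0") (auto simp: is_partition_def)
      then show ?thesis using Suc by (intro exI[of _ n]) auto
    qed
  qed simp
  from this[of N] show ?thesis using that assms by (auto simp: is_partition_def)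
qed

lemma Vh_deriv:
  assumes "v \<in> Vh k N p" "is_partition N p" "i < N"
  obtains q where "degree q \<le> k + 1" "\<And>x. x \<in> {p i..p (Suc i)} \<Longrightarrow> v x = poly q x"
    "\<And>x. x \<in> {p i<..<p (Suc i)} \<Longrightarrow> (v has_real_derivative poly (pderiv q) x) (at x)"
proof -
  obtain q where q: "degree q \<le> k + 1" "\<And>x. x \<in> {p i..p (Suc i)} \<Longrightarrow> v x = poly q x"
    using assms unfolding Vh_def by blast
  have "(v has_real_derivative poly (pderiv q) x) (at x)" if "x \<in> {p i<..<p (Suc i)}" for x
    by (rule has_field_derivative_transform_within_open[OF poly_DERIV, of "{p i<..<p (Suc i)}"])
       (use that q(2) in auto)
  with q show ?thesis using that by blast
qed

lemma Vh_deriv_off_nodes: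
  assumes v: "v \<in> Vh k N p" and part: "is_partition N p" and t: "t \<in> {0..1} - p ` {..N}"
  shows "(v has_real_derivative deriv v t) (at t)"
proof -
  obtain i where i: "i < N" "t \<in> {p i..p (Suc i)}" using partition_cover[OF part] t by blast
  then have "t \<noteq> p i" "t \<noteq> p (Suc i)" using t by auto
  then have "t \<in> {p i<..<p (Suc i)}" using i by auto
  moreover obtain q where "\<And>x. x \<in> {p i<..<p (Suc i)} \<Longrightarrow> (v has_real_derivative poly (pderiv q) x) (at x)"
    using Vh_deriv[OF v part i(1)] by metis
  ultimately have "(v has_real_derivative poly (pderiv q) t) (at t)" by simp
  then show ?thesis using DERIV_imp_deriv by fastforce
qed

lemma Vh_deriv_has_integral:
  assumes v: "v \<in> Vh k N p" and part: "is_partition N p" and "0 \<le> a" "a \<le> b" "b \<le> 1"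
  shows "(deriv v has_integral v b - v a) {a..b}"
proof (rule fundamental_theorem_of_calculus_interior_strong[of "p ` {..N}"])
  show "(v has_vector_derivative deriv v x) (at x)" if "x \<in> {a<..<b} - p ` {..N}" for x
    using Vh_deriv_off_nodes[OF v part, of x] that assms
    by (simp add: has_real_derivative_iff_has_vector_derivative)
  show "continuous_on {a..b} v"
    using v assms unfolding Vh_def by (auto intro: continuous_on_subset)
qed (use assms in auto)

text \<open>At a kink \<open>deriv v\<close> is some unspecified real number. There are finitely
  many nodes, so adding the absolute values there to the element bounds covers the whole
  interval.\<close>

lemma Vh_deriv_bounded:
  assumes v: "v \<in> Vh k N p" and part: "is_partition N p"
  obtains K where "\<And>t. t \<in> {0..1} \<Longrightarrow> \<bar>deriv v t\<bar> \<le> K"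
proof -
  have "\<exists>B. \<forall>t\<in>{p i<..<p (Suc i)}. \<bar>deriv v t\<bar> \<le> B" if i: "i < N" for i
  proof -
    obtain q where q: "\<And>x. x \<in> {p i<..<p (Suc i)} \<Longrightarrow> (v has_real_derivative poly (pderiv q) x) (at x)"
      using Vh_deriv[OF v part i] by metis
    have "continuous_on {p i..p (Suc i)} (poly (pderiv q))" by (intro continuous_intros)
    then obtain B where "\<forall>t\<in>{p i..p (Suc i)}.  \<bar>poly (pderiv q) t\<bar> \<le> B"
      by (rule continuous_on_Icc_abs_bounded)
    then show ?thesis using DERIV_imp_deriv[OF q] by (intro exI[of _ B]) auto
  qed
  then obtain B where B: "\<And>i t. i < N \<Longrightarrow> t \<in> {p i<..<p (Suc i)} \<Longrightarrow> \<bar>deriv v t\<bar> \<le> B i"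
    by metis
  let ?K = "(\<Sum>i<N. \<bar>B i\<bar>) + (\<Sum>i\<le>N. \<bar>deriv v (p i)\<bar>)"
  have "\<bar>deriv v t\<bar> \<le> ?K" if t: "t \<in> {0..1}" for t
  proof -
    obtain i where i: "i < N" "t \<in> {p i..p (Suc i)}" using partition_cover[OF part t] by blast
    have s: "(\<Sum>i<N. \<bar>B i\<bar>) \<ge> 0" "(\<Sum>i\<le>N. \<bar>deriv v (p i)\<bar>) \<ge> 0" by (auto intro: sum_nonneg)
    consider j where "j \<le> N" "t = p j" | "t \<in> {p i<..<p (Suc i)}"
      using i by (metis atLeastAtMost_iff greaterThanLessThan_iff less_eq_real_def less_imp_le_nat Suc_leI)
    then show ?thesis
    proof cases
      case 1
      then have "\<bar>deriv v t\<bar> \<le> (\<Sum>i\<le>N. \<bar>deriv v (p i)\<bar>)"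
        by (auto intro: member_le_sum[of _ _ "\<lambda>i. \<bar>deriv v (p i)\<bar>"])
      then show ?thesis using s by linarith
    next
      case 2
      have "\<bar>deriv v t\<bar> \<le> \<bar>B i\<bar>" using B[OF i(1) 2] by linarith
      also have "\<dots> \<le> (\<Sum>i<N. \<bar>B i\<bar>)" using i by (intro member_le_sum[of i]) auto
      finally show ?thesis using s by linarith
    qed
  qed
  then show ?thesis using that by blast
qed

section \<open>Orthogonality on a single element\<close>

lemma centred_moments:
  fixes a b :: real
  defines "m \<equiv> (a + b) / 2"
  assumes "a \<le> b"
  shows "((\<lambda>t. t - m) has_integral 0) {a..b}"
    and "((\<lambda>t. (t - m) * (t - m)) has_integral (b - a) ^ 3 / 12) {a..b}"
proof -
  have "((\<lambda>t. t - m) has_integral (b - m)\<^sup>2 / 2 - (a - m)\<^sup>2 / 2) {a..b}"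
    using \<open>a \<le> b\<close> by (intro fundamental_theorem_of_calculus)
      (auto simp: has_real_derivative_iff_has_vector_derivative[symmetric] intro!: derivative_eq_intros)
  moreover have "(b - m)\<^sup>2 / 2 - (a - m)\<^sup>2 / 2 = 0"
    by (simp add: m_def field_simps power2_eq_square)
  ultimately show "((\<lambda>t. t - m) has_integral 0) {a..b}" by simp
  have "((\<lambda>t. (t - m) * (t - m)) has_integral (b - m) ^ 3 / 3 - (a - m) ^ 3 / 3) {a..b}"
    using \<open>a \<le> b\<close> by (intro fundamental_theorem_of_calculus)
      (auto simp: has_real_derivative_iff_has_vector_derivative[symmetric] power2_eq_square intro!: derivative_eq_intros)
  moreover have "(b - m) ^ 3 / 3 - (a - m) ^ 3 / 3 = (b - a) ^ 3 / 12"
    by (simp add: m_def field_simps power3_eq_cube)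
  ultimately show "((\<lambda>t. (t - m) * (t - m)) has_integral (b - a) ^ 3 / 12) {a..b}" by simp
qed

text \<open>Orthogonality determines the affine part from the remainder: the mean of the remainder
  is \<open>- A\<close>, and its first moment about \<open>m\<close> is \<open>- B\<close> times the
  second moment of the interval. Centring at the midpoint decouples the two. This gives
  \<open>A\<close> at most \<rho> and the slope contribution at most \<open>3 * \<rho>\<close> in
  absolute value; with the remainder itself the total is \<open>5 * \<rho>\<close>. The alternative
  \<open>B = 0\<close> serves piecewise linear elements, where only constants are available for
  testing.\<close>

lemma orthogonal_remainder_bound:
  fixes \<epsilon> :: "real \<Rightarrow> real" and a b :: real
  defines "m \<equiv> (a + b) / 2"
  assumes "a < b" and int: "\<epsilon> integrable_on {a..b}" and bd: "\<And>t. t \<in> {a..b} \<Longrightarrow> \<bar>\<epsilon> t\<bar> \<le> M"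
    and \<rho>: "0 \<le> \<rho>" and near: "\<And>t. t \<in> {a<..<b} \<Longrightarrow> \<bar>\<epsilon> t - (A + B * (t - m))\<bar> \<le> \<rho>"
    and orth0: "integral {a..b} \<epsilon> = 0"
    and orth1: "B = 0 \<or> integral {a..b} (\<lambda>t. (t - m) * \<epsilon> t) = 0"
    and t: "t \<in> {a<..<b}"
  shows "\<bar>\<epsilon> t\<bar> \<le> 5 * \<rho>"
proof -
  let ?r = "\<lambda>t. \<epsilon> t - (A + B * (t - m))"
  have half: "\<bar>s - m\<bar> \<le> (b - a) / 2" if "s \<in> {a..b}" for s
    using that by (auto simp: m_def abs_le_iff field_simps)
  note mom = centred_moments[of a b, folded m_def]
  have e: "(\<epsilon> has_integral 0) {a..b}" using int orth0 by (metis integrable_integral)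
  have "(?r has_integral 0 - ((b - a) * A + B * 0)) {a..b}"
    using has_integral_diff[OF e has_integral_add[OF has_integral_const_real[of A a b]
        has_integral_mult_right[OF mom(1), of B]]] \<open>a < b\<close> by simp
  then have "\<bar>A\<bar> * (b - a) = \<bar>integral {a..b} ?r\<bar>"
    using \<open>a < b\<close> by (simp add: integral_unique abs_mult mult.commute)
  also have "\<dots> \<le> \<rho> * (b - a)"
    by (rule abs_integral_le_bound_finite[of _ _ "{a,b}"]) (use assms in auto)
  finally have A: "\<bar>A\<bar> \<le> \<rho>" using \<open>a < b\<close> by simp
  have B: "\<bar>B\<bar> * ((b - a) / 2) \<le> 3 * \<rho>"
  proof (cases "B = 0")
    case False
    have "(\<lambda>t. (t - m) * \<epsilon> t) integrable_on {a..b}"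
      by (intro set_lebesgue_integral_eq_integral(1)
        absolutely_integrable_mult_bounded[OF int bd] absolutely_integrable_continuous_real continuous_intros)
    then have "((\<lambda>t. (t - m) * \<epsilon> t) has_integral 0) {a..b}"
      using False orth1 by (metis integrable_integral)
    from has_integral_diff[OF this has_integral_add[OF has_integral_mult_right[OF mom(1), of A]
        has_integral_mult_right[OF mom(2), of B]]] \<open>a < b\<close>
    have "((\<lambda>t. (t - m) * ?r t) has_integral - (B * ((b - a) ^ 3 / 12))) {a..b}"
      by (simp add: algebra_simps)
    then have "\<bar>B\<bar> * ((b - a) ^ 3 / 12) = \<bar>integral {a..b} (\<lambda>t. (t - m) * ?r t)\<bar>"
      using \<open>a < b\<close> by (simp add: integral_unique abs_mult)
    also have "\<dots> \<le> ((b - a) / 2 * \<rho>) * (b - a)"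
    proof (rule abs_integral_le_bound_finite[of _ _ "{a,b}"])
      show "\<bar>(s - m) * ?r s\<bar> \<le> (b - a) / 2 * \<rho>" if "s \<in> {a..b} - {a,b}" for s
        unfolding abs_mult using that \<open>a < b\<close> by (intro mult_mono half near) auto
    qed (use \<open>a < b\<close> \<rho> in auto)
    finally have "\<bar>B\<bar> * ((b - a) ^ 3 / 12) \<le> (b - a) / 2 * \<rho> * (b - a)" .
    moreover have "\<bar>B\<bar> * (l ^ 3 / 12) = (\<bar>B\<bar> * (l / 2)) * (l\<^sup>2 / 6)"
      "l / 2 * \<rho> * l = (3 * \<rho>) * (l\<^sup>2 / 6)" for l
      by (simp_all add: power2_eq_square power3_eq_cube)
    ultimately have "(\<bar>B\<bar> * ((b - a) / 2)) * ((b - a)\<^sup>2 / 6) \<le> (3 * \<rho>) * ((b - a)\<^sup>2 / 6)"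
      by (simp only:)
    then show ?thesis using \<open>a < b\<close> by (subst (asm) mult_le_cancel_right) auto
  qed (use \<rho> in auto)
  have "\<bar>B * (t - m)\<bar> \<le> \<bar>B\<bar> * ((b - a) / 2)"
    using half[of t] t unfolding abs_mult by (intro mult_left_mono) auto
  then show ?thesis using near[OF t] A B by linarith
qed

text \<open>Not a local function: the power grows on \<open>{a..b}\<close>, stays constant
  afterwards, and a global linear term restores the value 0 at 1. Its derivative is a power on one
  element minus a constant, and the constant is invisible to an error of mean zero.\<close>

definition bubble :: "real \<Rightarrow> real \<Rightarrow> nat \<Rightarrow> real \<Rightarrow> real" where
  "bubble a b j t = (max a (min t b) - a) ^ j - (b - a) ^ j * t"

lemma bubble_in_Vh:
  assumes part: "is_partition N p" and i: "i < N" and j: "1 \<le> j" "j \<le> k + 1"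
  shows "bubble (p i) (p (Suc i)) j \<in> Vh k N p"
proof -
  have lt: "p i < p (Suc i)" using part i by (simp add: is_partition_def)
  note bnd = partition_in_unit_interval[OF part, of i] partition_in_unit_interval[OF part, of "Suc i"]
  let ?m = "(p (Suc i) - p i) ^ j"
  have "\<exists>q. degree q \<le> k + 1 \<and> (\<forall>x\<in>{p l..p (Suc l)}. bubble (p i) (p (Suc i)) j x = poly q x)"
    if l: "l < N" for l
  proof -
    consider "Suc l \<le> i" | "l = i" | "Suc i \<le> l" by linarith
    then show ?thesis
    proof cases
      case 1
      have "p (Suc l) \<le> p i" using partition_mono[OF part 1] i by simp
      then show ?thesis using lt j
        by (intro exI[of _ "[:0, - ?m:]"]) (auto simp: bubble_def)
    next
      case 2
      have "degree ([:- p i, 1:] ^ j - [:0, ?m:]) \<le> k + 1"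
        using j by (intro degree_diff_le) (auto simp: degree_linear_power)
      then show ?thesis using 2 lt
        by (intro exI[of _ "[:- p i, 1:] ^ j - [:0, ?m:]"]) (auto simp: bubble_def)
    next
      case 3
      have "p (Suc i) \<le> p l" using partition_mono[OF part 3] l by simp
      then show ?thesis using lt
        by (intro exI[of _ "[:?m, - ?m:]"]) (auto simp: bubble_def)
    qed
  qed
  moreover have "continuous_on {0..1} (bubble (p i) (p (Suc i)) j)"
    unfolding bubble_def by (intro continuous_intros)
  ultimately show ?thesis
    using bnd lt i j by (auto simp: Vh_def bubble_def)
qed

lemma bubble_has_derivative:
  assumes "a < b" "t \<noteq> a" "t \<noteq> b"
  shows "(bubble a b j has_real_derivative
     (if t \<in> {a..b} then real j * (t - a) ^ (j - 1) else 0) - (b - a) ^ j) (at t)"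
proof -
  consider "t < a" | "a < t" "t < b" | "b < t" using assms by linarith
  then show ?thesis
  proof cases
    case 1
    have "((\<lambda>t. 0 ^ j - (b - a) ^ j * t) has_real_derivative 0 - (b - a) ^ j) (at t)"
      by (auto intro!: derivative_eq_intros)
    then have "(bubble a b j has_real_derivative 0 - (b - a) ^ j) (at t)"
      by (rule has_field_derivative_transform_within_open[of _ _ _ "{..<a}"])
         (use 1 assms in \<open>auto simp: bubble_def\<close>)
    then show ?thesis using 1 by simp
  next
    case 2
    have "((\<lambda>t. (t - a) ^ j - (b - a) ^ j * t) has_real_derivative real j * (t - a) ^ (j - 1) - (b - a) ^ j) (at t)"
      by (auto intro!: derivative_eq_intros)
    then have "(bubble a b j has_real_derivative real j * (t - a) ^ (j - 1) - (b - a) ^ j) (at t)"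
      by (rule has_field_derivative_transform_within_open[of _ _ _ "{a<..<b}"])
         (use 2 assms in \<open>auto simp: bubble_def\<close>)
    then show ?thesis using 2 by simp
  next
    case 3
    have "((\<lambda>t. (b - a) ^ j - (b - a) ^ j * t) has_real_derivative 0 - (b - a) ^ j) (at t)"
      by (auto intro!: derivative_eq_intros)
    then have "(bubble a b j has_real_derivative 0 - (b - a) ^ j) (at t)"
      by (rule has_field_derivative_transform_within_open[of _ _ _ "{b<..}"])
         (use 3 assms in \<open>auto simp: bubble_def\<close>)
    then show ?thesis using 3 by simp
  qed
qed

text \<open>The error \<open>w' - w\<^sub>h'\<close> of the Galerkin method, using \<open>w' = \<integral>F - F\<close> for a primitive \<open>F\<close> of \<open>f\<close>.
  It is set to zero on the nodes \<open>S\<close>, where \<open>deriv w\<^sub>h\<close> is meaningless.\<close>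

definition flux_error :: "(real \<Rightarrow> real) \<Rightarrow> (real \<Rightarrow> real) \<Rightarrow> real set \<Rightarrow> real \<Rightarrow> real" where
  "flux_error f wh S t = (if t \<in> S then 0 else
     integral {0..1} (\<lambda>s. integral {0..s} f) - integral {0..t} f - deriv wh t)"

section \<open>Orthogonality and size of the flux error\<close>

locale galerkin_solution =
  fixes N k :: nat and p :: "nat \<Rightarrow> real" and f wh :: "real \<Rightarrow> real" and W :: real
  assumes part: "is_partition N p"
    and f: "f integrable_on {0..1}" and fW: "\<And>t. t \<in> {0..1} \<Longrightarrow> \<bar>f t\<bar> \<le> W"
    and wh: "wh \<in> Vh k N p"
    and galerkin: "\<And>v. v \<in> Vh k N p \<Longrightarrow>
      integral {0..1} (\<lambda>x. deriv wh x * deriv v x) = integral {0..1} (\<lambda>x. f x * v x)"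
begin

abbreviation "err \<equiv> flux_error f wh (p ` {..N})"
abbreviation "prim \<equiv> \<lambda>t. integral {0..t} f"

lemma prim_continuous: "continuous_on {0..1} prim"
  by (rule indefinite_integral_continuous_1[OF f])

lemma prim_integrable: "prim integrable_on {0..1}"
  by (rule integrable_continuous_real[OF prim_continuous])

lemma Vh_deriv_integrable:
  assumes "v \<in> Vh k N p" shows "deriv v integrable_on {0..1}" "integral {0..1} (deriv v) = 0"
proof -
  have "(deriv v has_integral v 1 - v 0) {0..1}"
    by (rule Vh_deriv_has_integral[OF assms part]) auto
  moreover have "v 0 = 0" "v 1 = 0" using assms by (auto simp: Vh_def)
  ultimately show "deriv v integrable_on {0..1}" "integral {0..1} (deriv v) = 0"
    by (auto simp: integral_unique)
qed

lemma flux_error_integrable: "err integrable_on {0..1}" "integral {0..1} err = 0"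
proof -
  let ?e = "\<lambda>t. integral {0..1} prim - prim t - deriv wh t"
  have i: "?e integrable_on {0..1}"
    by (intro integrable_diff integrable_const_ivl prim_integrable Vh_deriv_integrable wh)
  show "err integrable_on {0..1}"
    by (rule integrable_spike_finite[OF _ _ i, of "p ` {..N}"]) (auto simp: flux_error_def)
  have "integral {0..1} err = integral {0..1} ?e"
    by (rule integral_spike[of "p ` {..N}"]) (auto simp: flux_error_def)
  also have "\<dots> = integral {0..1} (\<lambda>t. integral {0..1} prim - prim t) - integral {0..1} (deriv wh)"
    by (intro integral_diff integrable_diff integrable_const_ivl prim_integrable Vh_deriv_integrable wh)
  also have "\<dots> = 0"
    using Vh_deriv_integrable(2)[OF wh]
      integral_diff[OF integrable_const_ivl prim_integrable, of "integral {0..1} prim"] by simp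
  finally show "integral {0..1} err = 0" .
qed

lemma flux_error_bounded: obtains M where "\<forall>t\<in>{0..1}. \<bar>err t\<bar> \<le> M"
proof -
  obtain A where A: "\<forall>t\<in>{0..1}. \<bar>prim t\<bar> \<le> A"
    by (rule continuous_on_Icc_abs_bounded[OF prim_continuous])
  obtain K where K: "\<And>t. t \<in> {0..1} \<Longrightarrow> \<bar>deriv wh t\<bar> \<le> K"
    using Vh_deriv_bounded[OF wh part] by metis
  have "\<bar>err t\<bar> \<le> \<bar>integral {0..1} prim\<bar> + A + K" if "t \<in> {0..1}" for t
    using bspec[OF A that] K[OF that] by (auto simp: flux_error_def)
  then show ?thesis using that by blast
qed

text \<open>Integrating the load term by parts turns the Galerkin equation into orthogonality of
  \<open>- prim - deriv wh\<close> to \<open>deriv v\<close>. The constant in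
  \<open>flux_error\<close> can be added because \<open>deriv v\<close> has mean zero.\<close>

lemma flux_error_orthogonal:
  assumes v: "v \<in> Vh k N p"
  shows "integral {0..1} (\<lambda>t. deriv v t * err t) = 0"
proof -
  let ?c = "integral {0..1} prim"
  have v01: "v 0 = 0" "v 1 = 0" "continuous_on {0..1} v" using v by (auto simp: Vh_def)
  obtain K where K: "\<And>t. t \<in> {0..1} \<Longrightarrow> \<bar>deriv v t\<bar> \<le> K"
    using Vh_deriv_bounded[OF v part] by metis
  obtain K' where K': "\<And>t. t \<in> {0..1} \<Longrightarrow> \<bar>deriv wh t\<bar> \<le> K'"
    using Vh_deriv_bounded[OF wh part] by metis
  have "integral {0..1} (\<lambda>t. v t * f t) = v 1 * prim 1 - integral {0..1} (\<lambda>t. deriv v t * prim t)"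
    by (rule integral_by_parts_bounded[OF _ f fW v01(3), of "p ` {..N}"])
       (use Vh_deriv_off_nodes[OF v part] Vh_deriv_integrable[OF v] K in auto)
  then have parts: "integral {0..1} (\<lambda>t. f t * v t) = - integral {0..1} (\<lambda>t. deriv v t * prim t)"
    using v01 by (simp add: mult.commute)
  have i1: "(\<lambda>t. deriv v t * prim t) integrable_on {0..1}"
  proof -
    have "(\<lambda>t. prim t * deriv v t) absolutely_integrable_on {0..1}"
      by (rule absolutely_integrable_mult_bounded[OF Vh_deriv_integrable(1)[OF v] K
            absolutely_integrable_continuous_real[OF prim_continuous]])
    then show ?thesis by (simp add: absolutely_integrable_on_def mult.commute)
  qed
  have i2: "(\<lambda>t. deriv v t * deriv wh t) integrable_on {0..1}"
  proof -
    have "deriv v absolutely_integrable_on {0..1}"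
      using absolutely_integrable_mult_bounded[OF Vh_deriv_integrable(1)[OF v] K, of "\<lambda>_. 1"] by simp
    from absolutely_integrable_mult_bounded[OF Vh_deriv_integrable(1)[OF wh] K' this]
    show ?thesis by (simp add: absolutely_integrable_on_def)
  qed
  have "integral {0..1} (\<lambda>t. deriv v t * err t) =
      integral {0..1} (\<lambda>t. ?c * deriv v t - deriv v t * prim t - deriv v t * deriv wh t)"
    by (rule integral_spike[of "p ` {..N}"]) (auto simp: flux_error_def algebra_simps)
  also have "\<dots> = ?c * integral {0..1} (deriv v) - integral {0..1} (\<lambda>t. deriv v t * prim t)
      - integral {0..1} (\<lambda>t. deriv v t * deriv wh t)"
    using i1 i2 Vh_deriv_integrable(1)[OF v]
    by (simp add: integral_diff integrable_diff integrable_on_mult_right)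
  also have "\<dots> = 0"
    using parts galerkin[OF v] Vh_deriv_integrable(2)[OF v] by (simp add: mult.commute)
  finally show ?thesis .
qed

lemma flux_error_orthogonal_element:
  assumes i: "i < N" and j: "1 \<le> j" "j \<le> k + 1"
  shows "integral {p i..p (Suc i)} (\<lambda>t. (t - p i) ^ (j - 1) * err t) = 0"
proof -
  let ?K = "{p i..p (Suc i)}" and ?v = "bubble (p i) (p (Suc i)) j"
  have lt: "p i < p (Suc i)" using part i by (simp add: is_partition_def)
  have sub: "?K \<subseteq> {0..1}"
    using partition_in_unit_interval[OF part] i by (auto simp: order_trans)
  obtain M where M: "\<forall>t\<in>{0..1}. \<bar>err t\<bar> \<le> M" by (rule flux_error_bounded)
  have int: "(\<lambda>t. (t - p i) ^ (j - 1) * err t) integrable_on ?K"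
    by (intro set_lebesgue_integral_eq_integral(1)
        absolutely_integrable_mult_bounded[of _ _ _ M] absolutely_integrable_continuous_real
        continuous_intros integrable_subinterval_real[OF flux_error_integrable(1) sub])
       (use M sub in blast)
  let ?r = "\<lambda>t. if t \<in> ?K then (t - p i) ^ (j - 1) * err t else 0"
  have r: "?r integrable_on {0..1}" "integral {0..1} ?r = integral ?K (\<lambda>t. (t - p i) ^ (j - 1) * err t)"
    using int by (simp_all only: integrable_restrict_Int integral_restrict_Int Int_absorb2[OF sub])
  \<comment> \<open>The identity holds at every \<open>t\<close>: at the nodes, where the bubble may
    have a kink, \<open>err\<close> is 0 by definition.\<close>
  have "deriv ?v t * err t = real j * ?r t - (p (Suc i) - p i) ^ j * err t" for t
  proof (cases "t \<in> p ` {..N}")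
    case False
    then have "t \<noteq> p i" "t \<noteq> p (Suc i)" using i by auto
    then show ?thesis
      by (subst DERIV_imp_deriv[OF bubble_has_derivative[OF lt]]) (auto simp: algebra_simps)
  qed (simp add: flux_error_def)
  then have "0 = integral {0..1} (\<lambda>t. real j * ?r t - (p (Suc i) - p i) ^ j * err t)"
    using flux_error_orthogonal[OF bubble_in_Vh[OF part i j]] by simp
  also have "\<dots> = real j * integral {0..1} ?r - (p (Suc i) - p i) ^ j * integral {0..1} err"
    using r(1) flux_error_integrable(1) by (simp add: integral_diff integrable_on_mult_right)
  finally show ?thesis using r(2) flux_error_integrable(2) j by simp
qed

text \<open>On an element \<open>deriv wh\<close> is a polynomial of degree at most
  \<open>k\<close>, so together with the approximant of \<open>prim\<close> it forms an unknown
  affine part of \<open>err\<close>. No size estimate for \<open>wh\<close> enters: orthogonality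
  alone forces that part to be comparable to the approximation error.\<close>

lemma flux_error_pointwise_bound:
  assumes "k \<le> 1" and \<rho>: "0 \<le> \<rho>"
    and approx: "\<And>i. i < N \<Longrightarrow> \<exists>A B. (k = 0 \<longrightarrow> B = 0) \<and>
      (\<forall>t\<in>{p i..p (Suc i)}. \<bar>prim t - (A + B * t)\<bar> \<le> \<rho>)"
    and t: "t \<in> {0..1}"
  shows "\<bar>err t\<bar> \<le> 5 * \<rho>"
proof (cases "t \<in> p ` {..N}")
  case True
  then show ?thesis using \<rho> by (simp add: flux_error_def)
next
  case False
  obtain i where i: "i < N" "t \<in> {p i..p (Suc i)}" using partition_cover[OF part t] by blast
  then have "t \<noteq> p i" "t \<noteq> p (Suc i)" using False by auto
  then have t': "t \<in> {p i<..<p (Suc i)}" using i by auto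
  have sub: "{p i..p (Suc i)} \<subseteq> {0..1}"
    using partition_in_unit_interval[OF part] i by (auto simp: order_trans)
  obtain q where q: "degree q \<le> k + 1"
    "\<And>x. x \<in> {p i<..<p (Suc i)} \<Longrightarrow> (wh has_real_derivative poly (pderiv q) x) (at x)"
    using Vh_deriv[OF wh part i(1)] by metis
  define q0 q1 where "q0 = coeff (pderiv q) 0" and "q1 = coeff (pderiv q) 1"
  have deg: "degree (pderiv q) \<le> k" using q(1) by (simp add: degree_pderiv)
  have "pderiv q = [:q0, q1:]"
  proof (rule poly_eqI)
    fix n
    show "coeff (pderiv q) n = coeff [:q0, q1:] n"
      using deg \<open>k \<le> 1\<close> by (cases n; cases "n - 1") (auto simp: q0_def q1_def intro!: coeff_eq_0)
  qed
  then have dwh: "deriv wh s = q0 + q1 * s" if "s \<in> {p i<..<p (Suc i)}" for s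
    using DERIV_imp_deriv[OF q(2)[OF that]] by (simp add: mult.commute)
  have q1: "q1 = 0" if "k = 0" using deg that by (auto simp: q1_def intro!: coeff_eq_0)
  obtain A B where AB: "k = 0 \<longrightarrow> B = 0" "\<forall>t\<in>{p i..p (Suc i)}. \<bar>prim t - (A + B * t)\<bar> \<le> \<rho>"
    using approx[OF i(1)] by blast
  let ?m = "(p i + p (Suc i)) / 2" and ?c = "integral {0..1} prim"
  obtain M where M: "\<forall>t\<in>{0..1}. \<bar>err t\<bar> \<le> M" by (rule flux_error_bounded)
  have int: "err integrable_on {p i..p (Suc i)}"
    by (rule integrable_subinterval_real[OF flux_error_integrable(1) sub])
  have orth0: "integral {p i..p (Suc i)} err = 0"
    using flux_error_orthogonal_element[OF i(1), of 1] by simp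
  show ?thesis
  proof (rule orthogonal_remainder_bound[OF _ int])
    show "p i < p (Suc i)" using part i by (simp add: is_partition_def)
    show "\<bar>err s\<bar> \<le> M" if "s \<in> {p i..p (Suc i)}" for s using M sub that by blast
    show "\<bar>err s - ((?c - A - q0 - (B + q1) * ?m) + (- (B + q1)) * (s - ?m))\<bar> \<le> \<rho>"
      if s: "s \<in> {p i<..<p (Suc i)}" for s
    proof -
      have "s \<notin> p ` {..N}"
      proof
        assume "s \<in> p ` {..N}"
        then obtain l where l: "l \<le> N" "s = p l" by auto
        have "l \<le> i \<or> Suc i \<le> l" by linarith
        then show False using partition_mono[OF part, of l i] partition_mono[OF part, of "Suc i" l] l i s
          by auto
      qed
      then have "err s - ((?c - A - q0 - (B + q1) * m) + (- (B + q1)) * (s - m)) =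
          - (prim s - (A + B * s))" for m
        using dwh[OF s] by (simp add: flux_error_def algebra_simps)
      moreover have "\<bar>prim s - (A + B * s)\<bar> \<le> \<rho>" using AB(2) s by simp
      ultimately show ?thesis by (simp only: abs_minus_cancel)
    qed
    show "- (B + q1) = 0 \<or> integral {p i..p (Suc i)} (\<lambda>t. (t - ?m) * err t) = 0"
    proof (cases "k = 0")
      case False
      have "(\<lambda>t. (t - p i) * err t) integrable_on {p i..p (Suc i)}"
        by (intro set_lebesgue_integral_eq_integral(1)
            absolutely_integrable_mult_bounded[of _ _ _ M] absolutely_integrable_continuous_real
            continuous_intros int) (use M sub in blast)
      then have "integral {p i..p (Suc i)} (\<lambda>t. (t - p i) * err t - (?m - p i) * err t) =
          integral {p i..p (Suc i)} (\<lambda>t. (t - p i) * err t) - (?m - p i) * integral {p i..p (Suc i)} err"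
        using int by (simp only: integral_diff integrable_on_mult_right integral_mult_right)
      also have "\<dots> = 0"
        using orth0 flux_error_orthogonal_element[OF i(1), of 2] False by simp
      also have "(\<lambda>t. (t - p i) * err t - (?m - p i) * err t) = (\<lambda>t. (t - ?m) * err t)"
        by (simp only: left_diff_distrib[symmetric] diff_diff_eq2 diff_add_cancel)
      finally show ?thesis by (rule disjI2)
    qed (use AB q1 in simp)
  qed (use \<rho> orth0 t' in auto)
qed

lemma flux_error_primitive_bound:
  assumes bd: "\<And>t. t \<in> {0..1} \<Longrightarrow> \<bar>err t\<bar> \<le> e" and t: "t \<in> {0..1}"
  shows "\<bar>integral {0..t} err\<bar> \<le> e * mesh N p"
proof -
  have e0: "e \<ge> 0" using bd[OF t] by linarith
  have int: "err integrable_on {a..b}" if "0 \<le> a" "b \<le> 1" for a b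
    using integrable_subinterval_real[OF flux_error_integrable(1), of a b] that by auto
  have node: "integral {0..p i} err = 0" if "i \<le> N" for i
    using that
  proof (induction i)
    case 0
    then show ?case using part by (simp add: is_partition_def)
  next
    case (Suc i)
    have "integral {0..p i} err + integral {p i..p (Suc i)} err = integral {0..p (Suc i)} err"
      using partition_in_unit_interval[OF part] partition_mono[OF part, of i "Suc i"] Suc.prems
      by (intro Henstock_Kurzweil_Integration.integral_combine int) auto
    then show ?case using Suc flux_error_orthogonal_element[of i 1] by simp
  qed
  obtain i where i: "i < N" "t \<in> {p i..p (Suc i)}" using partition_cover[OF part t] by blast
  have pi: "0 \<le> p i" using partition_in_unit_interval[OF part] i by simp
  have "integral {0..p i} err + integral {p i..t} err = integral {0..t} err"
    using pi i t by (intro Henstock_Kurzweil_Integration.integral_combine int) auto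
  then have "\<bar>integral {0..t} err\<bar> = \<bar>integral {p i..t} err\<bar>" using node[of i] i by simp
  also have "\<dots> \<le> e * (t - p i)"
    by (rule abs_integral_le_bound) (use i t pi bd in auto)
  also have "\<dots> \<le> e * mesh N p"
    using partition_step_le_mesh[OF i(1), of p] i e0 by (intro mult_left_mono) auto
  finally show ?thesis .
qed

end

section \<open>The error of the reconstructed solution\<close>

locale galerkin_fractional = galerkin_solution +
  fixes g :: "real \<Rightarrow> real" and \<alpha> :: real
  assumes gW: "\<And>t. t \<in> {0..1} \<Longrightarrow> \<bar>g t\<bar> \<le> W" and wd: "weak_deriv f g"
    and \<alpha>: "1 < \<alpha>" "\<alpha> < 2" and k: "k = 0 \<or> k = 1"
begin

lemma mesh_positive: "mesh N p > 0"
  using part partition_step_le_mesh[of 0 N p] by (force simp: is_partition_def)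

text \<open>For \<open>k = 0\<close> the approximant is the value at the left node and
  \<open>prim\<close> is Lipschitz; for \<open>k = 1\<close> it is the chord, and the weak
  derivative gains one more power of the mesh size.\<close>

lemma prim_piecewise_approximation:
  assumes i: "i < N"
  shows "\<exists>A B. (k = 0 \<longrightarrow> B = 0) \<and>
    (\<forall>t\<in>{p i..p (Suc i)}. \<bar>prim t - (A + B * t)\<bar> \<le> W * mesh N p ^ (k + 1))"
proof -
  have lt: "p i < p (Suc i)" using part i by (simp add: is_partition_def)
  have bnd: "0 \<le> p i" "p (Suc i) \<le> 1" using partition_in_unit_interval[OF part] i by auto
  have W0: "W \<ge> 0" using fW[of 0] by (smt (verit) atLeastAtMost_iff)
  note step = partition_step_le_mesh[OF i, of p]
  from k show ?thesis
  proof
    assume "k = 0"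
    have "\<bar>prim t - prim (p i)\<bar> \<le> W * mesh N p" if t: "t \<in> {p i..p (Suc i)}" for t
    proof -
      have "prim (p i) + integral {p i..t} f = prim t"
        using bnd t integrable_subinterval_real[OF f, of 0 t]
        by (intro Henstock_Kurzweil_Integration.integral_combine) auto
      then have "\<bar>prim t - prim (p i)\<bar> = \<bar>integral {p i..t} f\<bar>" by simp
      also have "\<dots> \<le> W * (t - p i)"
        by (rule abs_integral_le_bound) (use t bnd fW in auto)
      also have "\<dots> \<le> W * mesh N p" using step t W0 by (intro mult_left_mono) auto
      finally show ?thesis .
    qed
    then show ?thesis using \<open>k = 0\<close> by (intro exI[of _ "prim (p i)"] exI[of _ 0]) auto
  next
    assume "k = 1"
    define B where "B = (prim (p (Suc i)) - prim (p i)) / (p (Suc i) - p i)"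
    have "\<bar>prim t - ((prim (p i) - B * p i) + B * t)\<bar> \<le> W * mesh N p ^ (k + 1)"
      if t: "t \<in> {p i..p (Suc i)}" for t
    proof -
      have "\<bar>prim t - (prim (p i) + B * (t - p i))\<bar> \<le> W * (p (Suc i) - p i)\<^sup>2"
        unfolding B_def
        by (rule weak_deriv_primitive_interpolation[OF f fW gW wd bnd(1) lt bnd(2) t])
      also have "\<dots> \<le> W * (mesh N p)\<^sup>2"
        using step lt W0 by (intro mult_left_mono power_mono) auto
      finally show ?thesis using \<open>k = 1\<close> by (simp add: algebra_simps power2_eq_square)
    qed
    then show ?thesis using \<open>k = 1\<close>
      by (intro exI[of _ "prim (p i) - B * p i"] exI[of _ B]) auto
  qed
qed

text \<open>After integration by parts the fractional integral of \<open>f\<close> and the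
  fractional derivative of \<open>wh\<close> share one kernel, so they merge with the constant of
  \<open>flux_error\<close>, whose contribution is integrated explicitly.\<close>

lemma solution_error_representation:
  assumes x: "x \<in> {0..1}"
  shows "integral {0..x} (\<lambda>t. (x - t) powr (\<alpha> - 1 - 1) * err t) =
    integral {0..1} prim * (x powr (\<alpha> - 1) / (\<alpha> - 1)) -
      Gamma (\<alpha> - 1) * (frac_int \<alpha> f x + RL_deriv (2 - \<alpha>) wh x)"
proof -
  let ?a = "\<alpha> - 1" and ?c = "integral {0..1} prim"
  have "?a \<notin> \<int>\<^sub>\<le>\<^sub>0" using \<alpha> nonpos_Ints_nonpos[of ?a] by auto
  then have G: "Gamma ?a > 0" "Gamma \<alpha> = ?a * Gamma ?a"
    using \<alpha> Gamma_plus1[of ?a] by (auto simp: Gamma_real_pos)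
  have sub: "u integrable_on {0..x}" if "u integrable_on {0..1}" for u :: "real \<Rightarrow> real"
    using integrable_subinterval_real[OF that] x by auto
  obtain A where A: "\<forall>t\<in>{0..1}. \<bar>prim t\<bar> \<le> A"
    using continuous_on_Icc_abs_bounded[OF indefinite_integral_continuous_1[OF f]] by blast
  obtain K where K: "\<And>t. t \<in> {0..1} \<Longrightarrow> \<bar>deriv wh t\<bar> \<le> K"
    using Vh_deriv_bounded[OF wh part] by metis
  have dwh: "deriv wh integrable_on {0..1}"
    using Vh_deriv_has_integral[OF wh part, of 0 1] by auto
  have i1: "(\<lambda>t. (x - t) powr (?a - 1) * prim t) integrable_on {0..x}"
    by (rule powr_kernel_mult_integrable[where M = A])
       (use A x \<alpha> sub integrable_continuous_real[OF indefinite_integral_continuous_1[OF f]] in auto)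
  have i2: "(\<lambda>t. (x - t) powr (?a - 1) * deriv wh t) integrable_on {0..x}"
    by (rule powr_kernel_mult_integrable[where M = K]) (use K x \<alpha> sub dwh in auto)
  have i0: "((\<lambda>t. (x - t) powr (?a - 1)) has_integral (x powr ?a / ?a)) {0..x}"
    using powr_kernel_has_integral[of 0 x "?a - 1"] x \<alpha> by simp
  have by_parts: "integral {0..x} (\<lambda>t. (x - t) powr ?a * f t) = ?a * integral {0..x} (\<lambda>t. (x - t) powr (?a - 1) * prim t)"
    by (rule fractional_integral_by_parts[where M = W]) (use x \<alpha> sub[OF f] fW in auto)
  have G0: "Gamma ?a \<noteq> 0" using G(1) by (rule less_imp_neq[symmetric])
  have frac: "Gamma ?a * frac_int \<alpha> f x = integral {0..x} (\<lambda>t. (x - t) powr (?a - 1) * prim t)"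
    unfolding frac_int_def by_parts G(2) using \<alpha> by (simp add: G0)
  have RL: "Gamma ?a * RL_deriv (2 - \<alpha>) wh x = integral {0..x} (\<lambda>t. (x - t) powr (?a - 1) * deriv wh t)"
    by (simp add: RL_deriv_def G0)
  have "integral {0..x} (\<lambda>t. (x - t) powr (?a - 1) * err t) =
      integral {0..x} (\<lambda>t. ?c * (x - t) powr (?a - 1) - (x - t) powr (?a - 1) * prim t
        - (x - t) powr (?a - 1) * deriv wh t)"
    by (rule integral_spike[of "p ` {..N}"]) (auto simp: flux_error_def algebra_simps)
  also have "\<dots> = ?c * integral {0..x} (\<lambda>t. (x - t) powr (?a - 1)) - integral {0..x} (\<lambda>t. (x - t) powr (?a - 1) * prim t)
      - integral {0..x} (\<lambda>t. (x - t) powr (?a - 1) * deriv wh t)"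
    using i1 i2 has_integral_integrable[OF i0]
    by (simp add: integral_diff integrable_diff integrable_on_mult_right)
  also have "\<dots> = ?c * (x powr ?a / ?a) - Gamma ?a * (frac_int \<alpha> f x + RL_deriv (2 - \<alpha>) wh x)"
    unfolding integral_unique[OF i0] distrib_left frac RL by simp
  finally show ?thesis .
qed

lemma solution_error_pointwise:
  assumes x: "x \<in> {0..1}"
  shows "\<bar>exact_sol \<alpha> f x - post_sol \<alpha> wh x\<bar> \<le>
    10 * (1 / (\<alpha> - 1) + 2) / Gamma (\<alpha> - 1) * mesh N p powr (\<alpha> + real k) * W"
proof -
  let ?a = "\<alpha> - 1" and ?h = "mesh N p"
  \<comment> \<open>The 5 is the constant of \<open>orthogonal_remainder_bound\<close>. The error
    involves \<open>J\<close> both at \<open>x\<close> and at 1, which doubles it to the 10 of the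
    final constant.\<close>
  define e where "e = 5 * (W * ?h ^ (k + 1))"
  define J where "J = (\<lambda>x. integral {0..x} (\<lambda>t. (x - t) powr (?a - 1) * err t))"
  have W0: "W \<ge> 0" using fW[of 0] by (smt (verit) atLeastAtMost_iff)
  have G: "Gamma ?a > 0" using \<alpha> by (simp add: Gamma_real_pos)
  have bd: "\<bar>err t\<bar> \<le> e" if "t \<in> {0..1}" for t
    unfolding e_def
    by (rule flux_error_pointwise_bound[OF _ _ prim_piecewise_approximation that])
       (use k W0 mesh_positive in auto)
  have J: "\<bar>J y\<bar> \<le> e * ?h powr ?a * (1 / ?a + 2)" if "y \<in> {0..1}" for y
    unfolding J_def
    by (rule oscillating_kernel_bound[OF _ _ mesh_positive _ _ flux_error_integrable(1) bd
          flux_error_primitive_bound[OF bd]]) (use that \<alpha> in auto)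
  \<comment> \<open>The explicit power of \<open>x\<close> in the representation at \<open>x\<close>
    is matched by that at 1 multiplied by \<open>x powr ?a\<close>, so the difference is free of the
    constant.\<close>
  have repr: "Gamma ?a * (exact_sol \<alpha> f x - post_sol \<alpha> wh x) = J x - J 1 * x powr ?a"
  proof -
    let ?c = "integral {0..1} prim"
    have Jx: "J x = ?c * (x powr ?a / ?a) - Gamma ?a * (frac_int \<alpha> f x + RL_deriv (2 - \<alpha>) wh x)"
      unfolding J_def by (rule solution_error_representation[OF x])
    have J1: "J 1 = ?c * (1 powr ?a / ?a) - Gamma ?a * (frac_int \<alpha> f 1 + RL_deriv (2 - \<alpha>) wh 1)"
      unfolding J_def by (rule solution_error_representation) simp
    show ?thesis unfolding Jx J1 by (simp add: exact_sol_def post_sol_def algebra_simps)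
  qed
  have "x powr ?a \<le> 1" using x \<alpha> by (auto intro: powr_le1)
  then have "\<bar>J 1 * x powr ?a\<bar> \<le> \<bar>J 1\<bar> * 1" unfolding abs_mult by (intro mult_left_mono) auto
  then have "\<bar>J x - J 1 * x powr ?a\<bar> \<le> 2 * (e * ?h powr ?a * (1 / ?a + 2))"
    using J[OF x] J[of 1] by simp
  also have "e * ?h powr ?a = 5 * W * ?h powr (\<alpha> + real k)"
  proof -
    have "?h ^ (k + 1) * ?h powr ?a = ?h powr (real (k + 1) + ?a)"
      unfolding powr_add by (simp only: powr_realpow[OF mesh_positive])
    moreover have "real (k + 1) + ?a = \<alpha> + real k" by simp
    ultimately show ?thesis by (simp only: e_def mult.assoc)
  qed
  finally have "Gamma ?a * \<bar>exact_sol \<alpha> f x - post_sol \<alpha> wh x\<bar> \<le>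
      2 * (5 * W * ?h powr (\<alpha> + real k) * (1 / ?a + 2))"
    using G by (simp add: repr[symmetric] abs_mult)
  then have "\<bar>exact_sol \<alpha> f x - post_sol \<alpha> wh x\<bar> \<le>
      2 * (5 * W * ?h powr (\<alpha> + real k) * (1 / ?a + 2)) / Gamma ?a"
    using G by (simp add: pos_le_divide_eq mult.commute)
  moreover have "2 * (5 * W * X * Q) / Y = 10 * Q / Y * X * W" for X Q Y :: real by simp
  ultimately show ?thesis by (simp only:)
qed

end

section \<open>Norms and reduction to data bounded at every point\<close>

lemma L2_norm_le:
  assumes "\<And>x. x \<in> {0..1} \<Longrightarrow> \<bar>u x\<bar> \<le> B"
  shows "L2_norm u \<le> B"
proof -
  have B0: "B \<ge> 0" using assms[of 0] by (smt (verit) atLeastAtMost_iff)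
  have "\<bar>integral {0..1} (\<lambda>x. (u x)\<^sup>2)\<bar> \<le> B\<^sup>2 * (1 - 0)"
    by (rule abs_integral_le_bound) (use assms B0 in \<open>auto simp: abs_le_square_iff[symmetric]\<close>)
  then show ?thesis unfolding L2_norm_def using B0 by (intro real_le_lsqrt) auto
qed

text \<open>A negative essential bound would make the unit interval a null set, so the infimum is
  taken over a set bounded below. It is itself an essential bound, since countably many exceptional
  null sets, one for each \<open>1 / real (Suc n)\<close>, can be joined.\<close>

lemma Linf_norm_bound:
  assumes "Linf u"
  shows "0 \<le> Linf_norm u" and "AE x in lebesgue. x \<in> {0<..<1} \<longrightarrow> \<bar>u x\<bar> \<le> Linf_norm u"
proof -
  let ?S = "{M. AE x in lebesgue. x \<in> {0<..<1} \<longrightarrow> \<bar>u x\<bar> \<le> M}"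
  have ne: "?S \<noteq> {}" using assms by (auto simp: Linf_def)
  have nonneg: "M \<ge> 0" if "M \<in> ?S" for M
  proof (rule ccontr)
    assume "\<not> M \<ge> 0"
    then have "AE x in lebesgue. x \<notin> {0<..<1::real}"
      using that by (auto elim!: eventually_mono)
    then have "negligible {0<..<1::real}"
      by (simp add: negligible_iff_null_sets AE_iff_null_sets)
    then show False using negligible_interval(2)[of 0 "1::real"] by (simp add: box_real)
  qed
  show "0 \<le> Linf_norm u"
    unfolding Linf_norm_def by (rule cInf_greatest[OF ne nonneg])
  have "AE x in lebesgue. x \<in> {0<..<1} \<longrightarrow> \<bar>u x\<bar> \<le> Linf_norm u + 1 / real (Suc n)" for n
  proof -
    have "Inf ?S < Linf_norm u + 1 / real (Suc n)" by (simp add: Linf_norm_def)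
    then obtain M where "M \<in> ?S" "M < Linf_norm u + 1 / real (Suc n)"
      using cInf_lessD[OF ne] by blast
    then show ?thesis by (auto elim!: eventually_mono)
  qed
  then have "AE x in lebesgue. \<forall>n. x \<in> {0<..<1} \<longrightarrow> \<bar>u x\<bar> \<le> Linf_norm u + 1 / real (Suc n)"
    by (simp only: AE_all_countable) blast
  then show "AE x in lebesgue. x \<in> {0<..<1} \<longrightarrow> \<bar>u x\<bar> \<le> Linf_norm u"
  proof (rule eventually_mono, intro impI)
    fix x assume "\<forall>n. x \<in> {0<..<1} \<longrightarrow> \<bar>u x\<bar> \<le> Linf_norm u + 1 / real (Suc n)" "x \<in> {0<..<1}"
    then have "\<forall>n. \<bar>u x\<bar> \<le> Linf_norm u + 1 / real (Suc n)" by blast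
    moreover have "(\<lambda>n. Linf_norm u + 1 / real (Suc n)) \<longlonglongrightarrow> Linf_norm u + 0"
      by (intro tendsto_intros LIMSEQ_Suc[OF lim_1_over_n])
    ultimately show "\<bar>u x\<bar> \<le> Linf_norm u" by (intro LIMSEQ_le_const) auto
  qed
qed

text \<open>Clamping to the range from \<open>- W\<close> to \<open>W\<close> alters
  \<open>u\<close> on a null set only, yet makes the bound hold at every point, as the preceding
  estimates require. The data enter the solution, the Galerkin equation and the weak derivative only
  through integrals, so those do not notice the change.\<close>

lemma Linf_bounded_representative:
  assumes u: "Linf u" and W: "Linf_norm u \<le> W"
  obtains u' where "u' integrable_on {0..1}" "\<And>t. \<bar>u' t\<bar> \<le> W" "negligible {t \<in> {0..1}. u' t \<noteq> u t}"
proof -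
  define u' where "u' = (\<lambda>t. max (- W) (min W (u t)))"
  have W0: "W \<ge> 0" using Linf_norm_bound(1)[OF u] W by simp
  have b: "\<bar>u' t\<bar> \<le> W" for t using W0 by (auto simp: u'_def)
  have "u' \<in> borel_measurable (lebesgue_on {0<..<1})"
    using u unfolding u'_def Linf_def by (intro borel_measurable_max borel_measurable_min) auto
  then have "u' integrable_on {0<..<1}"
    by (rule measurable_bounded_by_integrable_imp_integrable[where g = "\<lambda>_. W"])
       (use b in \<open>auto simp: integrable_on_Icc_iff_Ioo[symmetric]\<close>)
  then have int: "u' integrable_on {0..1}" by (simp add: integrable_on_Icc_iff_Ioo)
  obtain Z where Z: "Z \<in> null_sets lebesgue" "{x. \<not> (x \<in> {0<..<1} \<longrightarrow> \<bar>u x\<bar> \<le> Linf_norm u)} \<subseteq> Z"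
    using Linf_norm_bound(2)[OF u] unfolding eventually_ae_filter by auto
  have "{t \<in> {0..1}. u' t \<noteq> u t} \<subseteq> {0, 1} \<union> Z"
  proof
    fix t assume t: "t \<in> {t \<in> {0..1}. u' t \<noteq> u t}"
    then have "\<not> \<bar>u t\<bar> \<le> Linf_norm u" using W by (auto simp: u'_def)
    then show "t \<in> {0, 1} \<union> Z" using t Z(2) by (cases "t = 0 \<or> t = 1") auto
  qed
  moreover have "negligible ({0, 1} \<union> Z)"
    using Z(1) by (intro negligible_Un) (auto simp: negligible_iff_null_sets)
  ultimately have "negligible {t \<in> {0..1}. u' t \<noteq> u t}" by (rule negligible_subset[rotated])
  with int b show ?thesis using that by blast
qed

theorem theorem4p8:
  fixes \<alpha> \<sigma> :: real and k :: nat
  assumes "1 < \<alpha>" and "\<alpha> < 2" and "k \<in> {0, 1}"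
  shows "\<exists>c. \<forall>N p f g wh.
    is_partition N p \<longrightarrow> quasi_uniform \<sigma> N p \<longrightarrow> W1inf f g \<longrightarrow>
    wh \<in> Vh k N p \<longrightarrow>
    (\<forall>v\<in>Vh k N p. integral {0..1} (\<lambda>x. deriv wh x * deriv v x) = integral {0..1} (\<lambda>x. f x * v x)) \<longrightarrow>
    L2_norm (\<lambda>x. exact_sol \<alpha> f x - post_sol \<alpha> wh x)
      \<le> c * mesh N p powr (\<alpha> + real k) * W1inf_norm f g"
proof (intro exI allI impI)
  fix N :: nat and p :: "nat \<Rightarrow> real" and f g wh :: "real \<Rightarrow> real"
  assume part: "is_partition N p" and W: "W1inf f g" and wh: "wh \<in> Vh k N p"
    and gal: "\<forall>v\<in>Vh k N p. integral {0..1} (\<lambda>x. deriv wh x * deriv v x) = integral {0..1} (\<lambda>x. f x * v x)"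
  have L: "Linf f" "Linf g" and wd: "weak_deriv f g" using W by (auto simp: W1inf_def)
  have le: "Linf_norm f \<le> W1inf_norm f g" "Linf_norm g \<le> W1inf_norm f g"
    using Linf_norm_bound(1)[OF L(1)] Linf_norm_bound(1)[OF L(2)] by (auto simp: W1inf_norm_def)
  obtain f' where f': "f' integrable_on {0..1}" "\<And>t. \<bar>f' t\<bar> \<le> W1inf_norm f g"
    "negligible {t \<in> {0..1}. f' t \<noteq> f t}"
    using Linf_bounded_representative[OF L(1) le(1)] by metis
  obtain g' where g': "\<And>t. \<bar>g' t\<bar> \<le> W1inf_norm f g" "negligible {t \<in> {0..1}. g' t \<noteq> g t}"
    using Linf_bounded_representative[OF L(2) le(2)] by metis
  \<comment> \<open>Leaving \<open>r\<close> an arbitrary function of the point and the value lets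
    one statement cover the fractional kernel, the load term and the weak derivative.\<close>
  have same_f: "integral {0..x} (\<lambda>t. r t (f' t)) = integral {0..x} (\<lambda>t. r t (f t))"
    if "x \<le> 1" for x and r :: "real \<Rightarrow> real \<Rightarrow> real"
    by (rule integral_spike[OF f'(3)]) (use that in auto)
  have same_g: "integral {0..1} (\<lambda>t. r t (g' t)) = integral {0..1} (\<lambda>t. r t (g t))"
    for r :: "real \<Rightarrow> real \<Rightarrow> real"
    by (rule integral_spike[OF g'(2)]) auto
  have wd': "weak_deriv f' g'"
    unfolding weak_deriv_def
    using wd same_f[of 1 "\<lambda>t y. y * deriv _ t"] same_g[of "\<lambda>t y. y * _ t"]
    by (simp add: weak_deriv_def)
  have gal': "integral {0..1} (\<lambda>x. deriv wh x * deriv v x) = integral {0..1} (\<lambda>x. f' x * v x)"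
    if "v \<in> Vh k N p" for v
    using gal that same_f[of 1 "\<lambda>t y. y * v t"] by simp
  show "L2_norm (\<lambda>x. exact_sol \<alpha> f x - post_sol \<alpha> wh x)
      \<le> 10 * (1 / (\<alpha> - 1) + 2) / Gamma (\<alpha> - 1) * mesh N p powr (\<alpha> + real k) * W1inf_norm f g"
  proof (rule L2_norm_le)
    \<comment> \<open>The full norm of the original \<open>f\<close> and \<open>g\<close> bounds
      both clamped functions, so it serves as the common constant \<open>W\<close>.\<close>
    interpret galerkin_fractional N k p f' wh "W1inf_norm f g" g' \<alpha>
      by standard (use part f' wh gal' g' wd' assms in auto)
    fix x :: real assume x: "x \<in> {0..1}"
    have "frac_int \<alpha> f y = frac_int \<alpha> f' y" if "y \<le> 1" for y
      using same_f[OF that, of "\<lambda>t z. (y - t) powr (\<alpha> - 1) * z"] by (simp add: frac_int_def)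
    then have "exact_sol \<alpha> f x = exact_sol \<alpha> f' x" using x by (simp add: exact_sol_def)
    moreover have "\<bar>exact_sol \<alpha> f' x - post_sol \<alpha> wh x\<bar> \<le>
      10 * (1 / (\<alpha> - 1) + 2) / Gamma (\<alpha> - 1) * mesh N p powr (\<alpha> + real k) * W1inf_norm f g"
      by (rule solution_error_pointwise[OF x])
    ultimately show "\<bar>exact_sol \<alpha> f x - post_sol \<alpha> wh x\<bar> \<le>
      10 * (1 / (\<alpha> - 1) + 2) / Gamma (\<alpha> - 1) * mesh N p powr (\<alpha> + real k) * W1inf_norm f g"
      by simp
  qed
qed

end
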